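(* Let $(\varepsilon_i)_{i\in\mathbb{Z}}$ be independent and identically distributed real random variables, distributed as $\varepsilon$, let $(\theta_k)_{k\in\mathbb{Z}}$ be nonnegative constants with $\theta_k=0$ for all but a finite number of values of $k$ and $\theta_k\neq 0$ for some $k$, and put $X_i=\sum_k\theta_k\varepsilon_{i+k}$ for $i\in\mathbb{Z}$. Suppose that the distribution of $\varepsilon$ has a density $f$. Let $r$ be any integer that is not less than the difference between the largest and the least values of $k$ for which $\theta_k\neq 0$, and, for $x>0$, let $M=M(x)$ denote the number of integers $j$ with $|j|\leq r$ for which $X_j>x$. (i) If, for some constants $C>0$ and $0<\gamma<1$, $f(x)=\exp\{o(x^\gamma)\}\exp(-Cx^\gamma)$ as $x\to\infty$, and if there is no tie for the largest $\theta_k$ (that is, the maximum of the $\theta_k$'s is attained at a unique $k$), then, for each integer $i_0\geq 1$, $$P\left(X_i>x\text{ for some }i\text{ with }1\leq|i|\leq i_0\mid X_0>x\right)\to 0\qquad\text{as }x\to\infty.$$ (ii) If, for some constants $C,C_1>0$, $C_2\geq 0$ and $0<\gamma<1$, $f(x)\sim C_1x^{C_2}\exp(-Cx^\gamma)$ as $x\to\infty$, and if exactly $q\geq 2$ of the values of $\theta_k$ tie for the maximum (that is, the maximum of the $\theta_k$'s is attained at exactly $q$ indices $k$), then $$P(M=q\mid X_0>x)\to 1\qquad\text{as }x\to\infty.$$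
   Context: The notation $f(x)\sim g(x)$ means $f(x)/g(x)\to 1$. No condition is imposed on the lower tail of the distribution of $\varepsilon$. *)

theory Defs
  imports "HOL-Probability.Probability" "HOL-Library.Landau_Symbols"
begin

text \<open>The summation ranges over the support of \<open>\<theta>\<close>, so the value is the intended one only for
  finitely supported \<open>\<theta>\<close>.\<close>

definition moving_average :: "(int \<Rightarrow> real) \<Rightarrow> (int \<Rightarrow> 'a \<Rightarrow> real) \<Rightarrow> int \<Rightarrow> 'a \<Rightarrow> real" where
  "moving_average \<theta> \<epsilon> i \<omega> = (\<Sum>k | \<theta> k \<noteq> 0. \<theta> k * \<epsilon> (i + k) \<omega>)"

definition exceedance_count :: "(int \<Rightarrow> 'a \<Rightarrow> real) \<Rightarrow> int \<Rightarrow> real \<Rightarrow> 'a \<Rightarrow> nat" where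
  "exceedance_count X r x \<omega> = card {j. \<bar>j\<bar> \<le> r \<and> X j \<omega> > x}"

definition max_indices :: "(int \<Rightarrow> real) \<Rightarrow> int set" where
  "max_indices \<theta> = {k. \<forall>l. \<theta> l \<le> \<theta> k}"

end

theory Submission
  imports Defs "HOL-Real_Asymp.Real_Asymp"
begin

text \<open>Part (i): if \<open>X\<^sub>0\<close> and \<open>X\<^sub>i\<close> both exceed \<open>x\<close>, then so does
  \<open>(X\<^sub>0 + X\<^sub>i) / 2\<close>, a linear combination of the \<open>\<epsilon>\<^sub>k\<close> all of whose weights lie below the
  maximum \<open>m\<close> of \<open>\<theta>\<close> when this maximum has no tie. Its tail decays at a rate larger than
  \<open>C / m\<^sup>\<gamma>\<close>, whereas one large value of the dominant term alone gives \<open>P(X\<^sub>0 > x)\<close> a decay rate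
  arbitrarily close to \<open>C / m\<^sup>\<gamma>\<close>.

  Part (ii): densities bounded asymptotically by \<open>a W\<close> and \<open>b W\<close>, where
  \<open>W x = x\<^sup>p exp (- c x\<^sup>\<gamma>)\<close>, have a convolution bounded asymptotically by \<open>(a + b) W\<close>. Hence, up
  to a factor tending to 1, \<open>P(X\<^sub>0 > x)\<close> is at most \<open>q P(m \<epsilon> > x)\<close>. Conversely, this much mass is
  already carried by the \<open>q\<close> disjoint events that one of the \<open>\<epsilon>\<^sub>k\<close> with maximal weight lies in
  \<open>((x + B) / m, \<rho> x / m]\<close>, with \<open>\<rho> > 1\<close> close to 1, while all the others are bounded by a
  constant; there \<open>M = q\<close>, because the typical overshoot of \<open>m \<epsilon>\<close> over \<open>x\<close> has order
  \<open>x\<^bsup>1-\<gamma>\<^esup>\<close>, larger than any constant and smaller than any multiple of \<open>x\<close>.\<close>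

section \<open>Stretched exponential weights and their tails\<close>

text \<open>One family serves both parts: \<open>p = 0\<close> in part (i), where the factor
  exp(o(x^gamma)) is absorbed by changing the rate \<open>c\<close>, and
  \<open>p = C\<^sub>2\<close> in part (ii).\<close>

definition weibull_weight :: "real \<Rightarrow> real \<Rightarrow> real \<Rightarrow> real \<Rightarrow> real" where
  "weibull_weight p c \<gamma> x = x powr p * exp (- c * x powr \<gamma>)"

definition tail_integral :: "(real \<Rightarrow> ennreal) \<Rightarrow> real \<Rightarrow> ennreal" where
  "tail_integral g x = (\<integral>\<^sup>+t\<in>{x<..}. g t \<partial>lborel)"

lemma weibull_weight_nonneg [simp]: "0 \<le> weibull_weight p c \<gamma> x"
  by (simp add: weibull_weight_def)

lemma weibull_weight_pos: "0 < x \<Longrightarrow> 0 < weibull_weight p c \<gamma> x"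
  by (simp add: weibull_weight_def)

lemma measurable_weibull_weight [measurable]: "weibull_weight p c \<gamma> \<in> borel_measurable borel"
  unfolding weibull_weight_def by measurable

text \<open>Long-tailedness: as \<open>\<gamma> < 1\<close>, the increment
  \<open>(x + a) powr \<gamma> - x powr \<gamma>\<close> tends to 0, and the power factor changes by
  \<open>(1 + a / x) powr p\<close>, which tends to 1. Bounded perturbations therefore do not affect
  the asymptotics.\<close>

lemma weibull_weight_shift:
  assumes "0 < \<gamma>" "\<gamma> < 1"
  shows "((\<lambda>x. weibull_weight p c \<gamma> (x + a) / weibull_weight p c \<gamma> x) \<longlongrightarrow> 1) at_top"
proof -
  have "((\<lambda>x. (1 + a / x) powr p) \<longlongrightarrow> 1) at_top"
    by real_asymp
  moreover have "((\<lambda>x. (x + a) powr \<gamma> - x powr \<gamma>) \<longlongrightarrow> 0) at_top"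
    using assms by real_asymp
  hence "((\<lambda>x. exp (- c * ((x + a) powr \<gamma> - x powr \<gamma>))) \<longlongrightarrow> exp (- c * 0)) at_top"
    by (intro tendsto_intros)
  ultimately have "((\<lambda>x. (1 + a / x) powr p * exp (- c * ((x + a) powr \<gamma> - x powr \<gamma>))) \<longlongrightarrow> 1 * exp (- c * 0)) at_top"
    by (intro tendsto_mult)
  hence *: "((\<lambda>x. (1 + a / x) powr p * exp (- c * ((x + a) powr \<gamma> - x powr \<gamma>))) \<longlongrightarrow> 1) at_top"
    by simp
  have "\<forall>\<^sub>F x in at_top. (1 + a / x) powr p * exp (- c * ((x + a) powr \<gamma> - x powr \<gamma>))
      = weibull_weight p c \<gamma> (x + a) / weibull_weight p c \<gamma> x"
    using eventually_gt_at_top[of 0] eventually_gt_at_top[of "-a"]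
  proof eventually_elim
    case (elim x)
    have "1 + a / x = (x + a) / x" using elim by (simp add: field_simps)
    thus ?case using elim
      by (simp add: weibull_weight_def powr_divide exp_diff exp_minus field_simps)
  qed
  with * show ?thesis by (rule Lim_transform_eventually)
qed

text \<open>The condition \<open>p \<le> c * \<gamma> * x powr \<gamma>\<close> says that the
  logarithmic derivative at \<open>x\<close> is nonpositive. Instead of differentiating, the proof
  applies ln u \<le> u - 1 to u = (y/x)^gamma.\<close>

lemma weibull_weight_decreasing:
  assumes "p \<ge> 0" "c > 0" "\<gamma> > 0" "x > 0" "p \<le> c * \<gamma> * x powr \<gamma>" "x \<le> y"
  shows "weibull_weight p c \<gamma> y \<le> weibull_weight p c \<gamma> x"
proof -
  have "ln (y powr \<gamma> / x powr \<gamma>) \<le> y powr \<gamma> / x powr \<gamma> - 1"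
    using assms by (intro ln_le_minus_one) auto
  hence "\<gamma> * (ln y - ln x) \<le> (y powr \<gamma> - x powr \<gamma>) / x powr \<gamma>"
    using assms by (simp add: ln_div ln_powr diff_divide_distrib algebra_simps)
  moreover have "0 \<le> p / \<gamma>" using assms by simp
  ultimately have "p / \<gamma> * (\<gamma> * (ln y - ln x)) \<le> p / \<gamma> * ((y powr \<gamma> - x powr \<gamma>) / x powr \<gamma>)"
    by (rule mult_left_mono)
  also have "p / \<gamma> * ((y powr \<gamma> - x powr \<gamma>) / x powr \<gamma>) = p / (\<gamma> * x powr \<gamma>) * (y powr \<gamma> - x powr \<gamma>)"
    by simp
  also have "\<dots> \<le> c * (y powr \<gamma> - x powr \<gamma>)"
    using assms by (intro mult_right_mono) (auto simp: field_simps powr_mono2)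
  finally have "p * ln y - c * y powr \<gamma> \<le> p * ln x - c * x powr \<gamma>"
    using assms by (simp add: algebra_simps)
  hence "exp (p * ln y - c * y powr \<gamma>) \<le> exp (p * ln x - c * x powr \<gamma>)" by simp
  thus ?thesis using assms
    by (simp add: weibull_weight_def powr_def exp_diff exp_minus field_simps)
qed

text \<open>Monotonicity reduces all \<open>z \<ge> x - a\<close> to the single point
  \<open>x - a\<close>, where the shift lemma applies. The uniformity in \<open>z\<close> is what
  the outer ranges of the convolution integral require.\<close>

lemma weibull_weight_eventually_le:
  assumes "p \<ge> 0" "c > 0" "0 < \<gamma>" "\<gamma> < 1" "\<delta> > 0"
  shows "\<forall>\<^sub>F x in at_top. \<forall>z\<ge>x - a. weibull_weight p c \<gamma> z \<le> (1 + \<delta>) * weibull_weight p c \<gamma> x"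
proof -
  have "filterlim (\<lambda>x. c * \<gamma> * (x - a) powr \<gamma>) at_top at_top"
    using assms by real_asymp
  hence "\<forall>\<^sub>F x in at_top. p \<le> c * \<gamma> * (x - a) powr \<gamma>"
    by (simp add: filterlim_at_top)
  moreover have "\<forall>\<^sub>F x in at_top. weibull_weight p c \<gamma> (x + - a) / weibull_weight p c \<gamma> x < 1 + \<delta>"
    using weibull_weight_shift[OF assms(3,4)] by (rule order_tendstoD) (use assms in simp)
  ultimately show ?thesis using eventually_gt_at_top[of 0] eventually_gt_at_top[of a]
  proof eventually_elim
    case (elim x)
    have "weibull_weight p c \<gamma> (x - a) \<le> (1 + \<delta>) * weibull_weight p c \<gamma> x"
      using elim weibull_weight_pos[of x p c \<gamma>] by (simp add: field_simps)
    with elim assms show ?case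
      by (meson weibull_weight_decreasing diff_gt_0_iff_gt order_trans)
  qed
qed

text \<open>Concavity: the increment is at most gamma y (x - y)^(gamma - 1), and
  \<open>x - y \<ge> y\<close> turns this into gamma y^gamma. Young's inequality, as weighted AM-GM,
  plays the part of the tangent line. The factor \<open>\<gamma> < 1\<close> on the right is the
  saving used below.\<close>

lemma powr_add_gap:
  fixes x y :: real
  assumes "0 < \<gamma>" "\<gamma> < 1" "0 < y" "2 * y \<le> x"
  shows "x powr \<gamma> \<le> (x - y) powr \<gamma> + \<gamma> * y powr \<gamma>"
proof -
  have "x powr \<gamma> * (x - y) powr (1 - \<gamma>) \<le> \<gamma> * x + (1 - \<gamma>) * (x - y)"
    using assms by (intro Youngs_inequality_0) auto
  hence "x powr \<gamma> \<le> (x - y + \<gamma> * y) * (x - y) powr (\<gamma> - 1)"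
    using assms by (simp add: powr_diff field_simps)
  also have "\<dots> = (x - y) powr \<gamma> + \<gamma> * (y * (x - y) powr (\<gamma> - 1))"
    using assms by (simp add: powr_diff field_simps)
  also have "(x - y) powr (\<gamma> - 1) \<le> y powr (\<gamma> - 1)"
    using assms by (intro powr_mono2') auto
  hence "(x - y) powr \<gamma> + \<gamma> * (y * (x - y) powr (\<gamma> - 1)) \<le> (x - y) powr \<gamma> + \<gamma> * (y * y powr (\<gamma> - 1))"
    using assms by simp
  also have "y * y powr (\<gamma> - 1) = y powr \<gamma>"
    using assms by (simp add: powr_diff)
  finally show ?thesis .
qed

text \<open>Splitting \<open>x\<close> into two summands costs a factor depending only on the
  smaller summand \<open>y\<close>. Its rate drops to \<open>c * (1 - \<gamma>)\<close>, which is
  still positive, so the factor remains integrable at infinity.\<close>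

lemma weibull_weight_mult_le:
  assumes "p \<ge> 0" "c > 0" "0 < \<gamma>" "\<gamma> < 1" "0 < y" "2 * y \<le> x"
  shows "weibull_weight p c \<gamma> (x - y) * weibull_weight p c \<gamma> y
    \<le> weibull_weight p c \<gamma> x * weibull_weight p (c * (1 - \<gamma>)) \<gamma> y"
proof -
  have "(x - y) powr p \<le> x powr p"
    using assms by (intro powr_mono2) auto
  moreover have "c * x powr \<gamma> \<le> c * ((x - y) powr \<gamma> + \<gamma> * y powr \<gamma>)"
    using powr_add_gap[of \<gamma> y x] assms by simp
  hence "exp (- c * (x - y) powr \<gamma> + - c * y powr \<gamma>) \<le> exp (- c * x powr \<gamma> + - (c * (1 - \<gamma>)) * y powr \<gamma>)"
    by (simp add: algebra_simps)
  ultimately have "(x - y) powr p * exp (- c * (x - y) powr \<gamma> + - c * y powr \<gamma>)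
     \<le> x powr p * exp (- c * x powr \<gamma> + - (c * (1 - \<gamma>)) * y powr \<gamma>)"
    by (intro mult_mono) auto
  hence "y powr p * ((x - y) powr p * exp (- c * (x - y) powr \<gamma> + - c * y powr \<gamma>))
     \<le> y powr p * (x powr p * exp (- c * x powr \<gamma> + - (c * (1 - \<gamma>)) * y powr \<gamma>))"
    by (intro mult_left_mono) auto
  thus ?thesis unfolding weibull_weight_def exp_add by (simp only: ac_simps)
qed

text \<open>One of \<open>y\<close> and \<open>x - y\<close> is at most half of \<open>x\<close>;
  the symmetric sum on the right covers both cases.\<close>

lemma weibull_weight_mult_le_sum:
  assumes "p \<ge> 0" "c > 0" "0 < \<gamma>" "\<gamma> < 1" "0 < y" "y < x"
  shows "weibull_weight p c \<gamma> (x - y) * weibull_weight p c \<gamma> y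
    \<le> weibull_weight p c \<gamma> x *
      (weibull_weight p (c * (1 - \<gamma>)) \<gamma> y + weibull_weight p (c * (1 - \<gamma>)) \<gamma> (x - y))"
proof (cases "2 * y \<le> x")
  case True
  from weibull_weight_mult_le[OF assms(1-5) True] show ?thesis
    by (auto simp: algebra_simps intro: order_trans add_increasing)
next
  case False
  hence "2 * (x - y) \<le> x" "0 < x - y" using assms by auto
  from weibull_weight_mult_le[OF assms(1-4) this(2,1)] show ?thesis
    by (auto simp: algebra_simps intro: order_trans add_increasing)
qed

text \<open>The inverse square is merely a convenient majorant with an explicit tail
  integral.\<close>

lemma weibull_weight_le_inverse_square:
  assumes "c > 0" "\<gamma> > 0"
  shows "\<forall>\<^sub>F x in at_top. weibull_weight p c \<gamma> x \<le> 1 / x\<^sup>2"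
proof -
  have "((\<lambda>x. x powr p * exp (- c * x powr \<gamma>) * x\<^sup>2) \<longlongrightarrow> 0) at_top"
    using assms by real_asymp
  hence "\<forall>\<^sub>F x in at_top. x powr p * exp (- c * x powr \<gamma>) * x\<^sup>2 < 1"
    by (rule order_tendstoD) simp
  thus ?thesis using eventually_gt_at_top[of 0]
    by eventually_elim (simp add: weibull_weight_def field_simps)
qed

lemma tail_integral_inverse_square:
  assumes "x > 0"
  shows "tail_integral (\<lambda>t. ennreal (1 / t\<^sup>2)) x = ennreal (1 / x)"
proof -
  have "(\<integral>\<^sup>+t. ennreal (1 / t\<^sup>2) * indicator {x..} t \<partial>lborel) = ennreal (0 - (- 1 / x))"
  proof (rule nn_integral_FTC_atLeast)
    show "DERIV (\<lambda>t. - 1 / t) t :> 1 / t\<^sup>2" if "x \<le> t" for t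
      using that assms by (auto intro!: derivative_eq_intros simp: power2_eq_square)
    show "((\<lambda>t. - 1 / t) \<longlongrightarrow> (0::real)) at_top" by real_asymp
  qed auto
  \<comment> \<open>The tail is taken over an open half-line, the fundamental theorem over a closed
    one; the endpoint is a null set.\<close>
  moreover have "tail_integral (\<lambda>t. ennreal (1 / t\<^sup>2)) x = (\<integral>\<^sup>+t. ennreal (1 / t\<^sup>2) * indicator {x..} t \<partial>lborel)"
    unfolding tail_integral_def
    by (intro nn_integral_cong_AE AE_mp[OF AE_lborel_singleton[of x] AE_I2]) (auto simp: indicator_def)
  ultimately show ?thesis by simp
qed

lemma tail_integral_mono:
  "(\<And>t. t > x \<Longrightarrow> g t \<le> h t) \<Longrightarrow> tail_integral g x \<le> tail_integral h x"
  unfolding tail_integral_def by (intro nn_integral_mono) (auto simp: indicator_def)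

lemma eventually_tail_integral_mono:
  assumes "\<forall>\<^sub>F t in at_top. g t \<le> h t"
  shows "\<forall>\<^sub>F x in at_top. tail_integral g x \<le> tail_integral h x"
proof -
  obtain N where "\<And>t. t \<ge> N \<Longrightarrow> g t \<le> h t"
    using assms by (auto simp: eventually_at_top_linorder)
  thus ?thesis
    by (intro eventually_mono[OF eventually_ge_at_top[of N]] tail_integral_mono) auto
qed

lemma tail_integral_weibull_weight:
  assumes "c > 0" "\<gamma> > 0" "\<delta> > 0"
  shows "\<forall>\<^sub>F x in at_top. tail_integral (\<lambda>t. ennreal (weibull_weight p c \<gamma> t)) x \<le> ennreal \<delta>"
proof -
  have "\<forall>\<^sub>F t in at_top. ennreal (weibull_weight p c \<gamma> t) \<le> ennreal (1 / t\<^sup>2)"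
    using weibull_weight_le_inverse_square[OF assms(1,2)]
    by eventually_elim (rule ennreal_leI)
  from eventually_tail_integral_mono[OF this] show ?thesis
    using eventually_gt_at_top[of 0] eventually_gt_at_top[of "1 / \<delta>"]
  proof eventually_elim
    case (elim x)
    note elim(1)
    also have "tail_integral (\<lambda>t. ennreal (1 / t\<^sup>2)) x = ennreal (1 / x)"
      using elim by (intro tail_integral_inverse_square)
    also have "\<dots> \<le> ennreal \<delta>"
      using elim assms by (intro ennreal_leI) (simp add: field_simps)
    finally show ?case .
  qed
qed

section \<open>Convolution of densities\<close>

text \<open>For eventually positive \<open>h\<close> this is limsup g/h \<le> a, written without
  division so that \<open>g\<close> may take values in \<open>ennreal\<close>. Quantifying over all
  \<open>\<kappa> > a\<close> lets \<open>a = 0\<close> express that \<open>g\<close> is negligible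
  against \<open>h\<close>.\<close>

definition asymp_dominated :: "(real \<Rightarrow> real) \<Rightarrow> real \<Rightarrow> (real \<Rightarrow> ennreal) \<Rightarrow> bool" where
  "asymp_dominated h a g \<longleftrightarrow> (\<forall>\<kappa>>a. \<forall>\<^sub>F x in at_top. g x \<le> ennreal (\<kappa> * h x))"

lemma nn_integral_lborel_reflect:
  fixes g :: "real \<Rightarrow> ennreal"
  assumes [measurable]: "g \<in> borel_measurable borel"
  shows "(\<integral>\<^sup>+y. g (x - y) \<partial>lborel) = (\<integral>\<^sup>+y. g y \<partial>lborel)"
  using nn_integral_real_affine[of g "-1" x] by simp

text \<open>Subexponentiality: the integral is split at \<open>A\<close> and \<open>x - A\<close>.
  If one argument is at most \<open>A\<close>, the density at the other is at most about
  \<open>a\<close> or \<open>b\<close> times the weight at \<open>x\<close>, and the remaining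
  density has mass at most 1. The middle range, where both arguments exceed \<open>A\<close>,
  contributes an arbitrarily small multiple of that weight.\<close>

lemma asymp_dominated_convolution:
  fixes g\<^sub>1 g\<^sub>2 :: "real \<Rightarrow> ennreal"
  assumes par: "p \<ge> 0" "c > 0" "0 < \<gamma>" "\<gamma> < 1" and "a \<ge> 0" "b \<ge> 0"
    and [measurable]: "g\<^sub>1 \<in> borel_measurable borel" "g\<^sub>2 \<in> borel_measurable borel"
    and int: "(\<integral>\<^sup>+y. g\<^sub>1 y \<partial>lborel) \<le> 1" "(\<integral>\<^sup>+y. g\<^sub>2 y \<partial>lborel) \<le> 1"
    and dom: "asymp_dominated (weibull_weight p c \<gamma>) a g\<^sub>1" "asymp_dominated (weibull_weight p c \<gamma>) b g\<^sub>2"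
  shows "asymp_dominated (weibull_weight p c \<gamma>) (a + b) (\<lambda>x. \<integral>\<^sup>+y. g\<^sub>1 (x - y) * g\<^sub>2 y \<partial>lborel)"
  unfolding asymp_dominated_def
proof (intro allI impI)
  fix \<kappa> assume \<kappa>: "a + b < \<kappa>"
  let ?W = "weibull_weight p c \<gamma>" and ?\<phi> = "weibull_weight p (c * (1 - \<gamma>)) \<gamma>"
  \<comment> \<open>This polynomial in \<open>\<delta>\<close> is the constant that the four terms
    of the final estimate produce; at 0 it equals \<open>a + b\<close>.\<close>
  have "((\<lambda>\<delta>. (a + \<delta>) * (1 + \<delta>) + (b + \<delta>) * (1 + \<delta>) + (a + \<delta>) * (b + \<delta>) * \<delta> + (a + \<delta>) * (b + \<delta>) * \<delta>)
      \<longlongrightarrow> (a + 0) * (1 + 0) + (b + 0) * (1 + 0) + (a + 0) * (b + 0) * 0 + (a + 0) * (b + 0) * 0) (at_right 0)"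
    by (intro tendsto_intros)
  hence "\<forall>\<^sub>F \<delta> in at_right 0. (a + \<delta>) * (1 + \<delta>) + (b + \<delta>) * (1 + \<delta>) + (a + \<delta>) * (b + \<delta>) * \<delta> + (a + \<delta>) * (b + \<delta>) * \<delta> < \<kappa>"
    by (rule order_tendstoD) (use \<kappa> in simp)
  from eventually_conj[OF eventually_at_right_less[of 0] this] obtain \<delta> where
    "0 < \<delta>" and \<delta>: "(a + \<delta>) * (1 + \<delta>) + (b + \<delta>) * (1 + \<delta>) + (a + \<delta>) * (b + \<delta>) * \<delta> + (a + \<delta>) * (b + \<delta>) * \<delta> < \<kappa>"
    using eventually_happens trivial_limit_at_right_real by blast
  have "\<forall>\<^sub>F x in at_top. g\<^sub>1 x \<le> ennreal ((a + \<delta>) * ?W x)" "\<forall>\<^sub>F x in at_top. g\<^sub>2 x \<le> ennreal ((b + \<delta>) * ?W x)"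
    using dom \<open>0 < \<delta>\<close> by (auto simp: asymp_dominated_def)
  then obtain N\<^sub>1 N\<^sub>2 where N: "\<And>x. x \<ge> N\<^sub>1 \<Longrightarrow> g\<^sub>1 x \<le> ennreal ((a + \<delta>) * ?W x)"
      "\<And>x. x \<ge> N\<^sub>2 \<Longrightarrow> g\<^sub>2 x \<le> ennreal ((b + \<delta>) * ?W x)"
    by (auto simp: eventually_at_top_linorder)
  have "\<forall>\<^sub>F A in at_top. tail_integral (\<lambda>t. ennreal (?\<phi> t)) A \<le> ennreal \<delta> \<and> A \<ge> N\<^sub>1 \<and> A \<ge> N\<^sub>2 \<and> A > 0"
    using par \<open>0 < \<delta>\<close> by (intro eventually_conj tail_integral_weibull_weight eventually_ge_at_top eventually_gt_at_top) auto
  then obtain A where A: "tail_integral (\<lambda>t. ennreal (?\<phi> t)) A \<le> ennreal \<delta>" "A \<ge> N\<^sub>1" "A \<ge> N\<^sub>2" "A > 0"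
    by (auto dest: eventually_happens)
  show "\<forall>\<^sub>F x in at_top. (\<integral>\<^sup>+y. g\<^sub>1 (x - y) * g\<^sub>2 y \<partial>lborel) \<le> ennreal (\<kappa> * ?W x)"
    \<comment> \<open>With \<open>x \<ge> 2 * A\<close>, the argument at which a density is
      estimated stays at least \<open>A\<close> in the outer ranges as well, hence beyond both
      thresholds of \<open>N\<close>.\<close>
    using weibull_weight_eventually_le[OF par \<open>0 < \<delta>\<close>, of A] eventually_ge_at_top[of "2 * A"]
  proof eventually_elim
    case (elim x)
    define K\<^sub>1 K\<^sub>2 K\<^sub>3 where K: "K\<^sub>1 = (a + \<delta>) * (1 + \<delta>) * ?W x" "K\<^sub>2 = (b + \<delta>) * (1 + \<delta>) * ?W x"
      "K\<^sub>3 = (a + \<delta>) * (b + \<delta>) * ?W x"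
    have K_nonneg: "0 \<le> K\<^sub>1" "0 \<le> K\<^sub>2" "0 \<le> K\<^sub>3"
      using \<open>a \<ge> 0\<close> \<open>b \<ge> 0\<close> \<open>0 < \<delta>\<close> by (auto simp: K)
    \<comment> \<open>Cutting the comparison function off at \<open>A\<close> makes its total
      integral at most \<open>\<delta>\<close>.\<close>
    define \<psi> :: "real \<Rightarrow> ennreal" where "\<psi> y = ennreal (?\<phi> y) * indicator {A<..} y" for y
    have [measurable]: "\<psi> \<in> borel_measurable borel" unfolding \<psi>_def by measurable
    \<comment> \<open>The ranges may overlap. In each of them the product is bounded by one or two
      of the four nonnegative terms, and adding the others does no harm.\<close>
    have ptw: "g\<^sub>1 (x - y) * g\<^sub>2 y \<le> K\<^sub>1 * g\<^sub>2 y + K\<^sub>2 * g\<^sub>1 (x - y) + K\<^sub>3 * \<psi> y + K\<^sub>3 * \<psi> (x - y)" for y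
    proof -
      consider "y \<le> A" | "y \<ge> x - A" | "A < y" "y < x - A" by linarith
      thus ?thesis
      proof cases
        case 1
        have "g\<^sub>1 (x - y) \<le> ennreal ((a + \<delta>) * ?W (x - y))" using 1 elim A by (intro N) auto
        also have "(a + \<delta>) * ?W (x - y) \<le> (a + \<delta>) * ((1 + \<delta>) * ?W x)"
          using elim 1 \<open>a \<ge> 0\<close> \<open>0 < \<delta>\<close> by (intro mult_left_mono) auto
        hence "ennreal ((a + \<delta>) * ?W (x - y)) \<le> ennreal K\<^sub>1" by (intro ennreal_leI) (simp add: K mult.assoc)
        finally have "g\<^sub>1 (x - y) * g\<^sub>2 y \<le> K\<^sub>1 * g\<^sub>2 y" by (rule mult_right_mono) simp
        thus ?thesis by (simp add: add_increasing2)
      next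
        case 2
        have "g\<^sub>2 y \<le> ennreal ((b + \<delta>) * ?W y)" using 2 elim A by (intro N) auto
        also have "(b + \<delta>) * ?W y \<le> (b + \<delta>) * ((1 + \<delta>) * ?W x)"
          using elim 2 \<open>b \<ge> 0\<close> \<open>0 < \<delta>\<close> by (intro mult_left_mono) auto
        hence "ennreal ((b + \<delta>) * ?W y) \<le> ennreal K\<^sub>2" by (intro ennreal_leI) (simp add: K mult.assoc)
        finally have "g\<^sub>1 (x - y) * g\<^sub>2 y \<le> g\<^sub>1 (x - y) * K\<^sub>2" by (rule mult_left_mono) simp
        also have "\<dots> = K\<^sub>2 * g\<^sub>1 (x - y)" by (rule mult.commute)
        finally show ?thesis by (simp add: add_increasing2 add_increasing)
      next
        case 3
        have "g\<^sub>1 (x - y) * g\<^sub>2 y \<le> ennreal ((a + \<delta>) * ?W (x - y)) * ennreal ((b + \<delta>) * ?W y)"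
          using 3 elim A by (intro mult_mono N) auto
        also have "\<dots> = ennreal ((a + \<delta>) * (b + \<delta>) * (?W (x - y) * ?W y))"
          using \<open>a \<ge> 0\<close> \<open>b \<ge> 0\<close> \<open>0 < \<delta>\<close> by (subst ennreal_mult[symmetric]) (auto simp: ac_simps)
        also have "\<dots> \<le> ennreal ((a + \<delta>) * (b + \<delta>) * (?W x * (?\<phi> y + ?\<phi> (x - y))))"
          using \<open>a \<ge> 0\<close> \<open>b \<ge> 0\<close> \<open>0 < \<delta>\<close> 3 A
          by (intro ennreal_leI mult_left_mono weibull_weight_mult_le_sum par) auto
        also have "(a + \<delta>) * (b + \<delta>) * (?W x * (?\<phi> y + ?\<phi> (x - y))) = K\<^sub>3 * ?\<phi> y + K\<^sub>3 * ?\<phi> (x - y)"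
          by (simp add: K algebra_simps)
        also have "ennreal \<dots> = K\<^sub>3 * \<psi> y + K\<^sub>3 * \<psi> (x - y)"
          using 3 K_nonneg by (simp add: \<psi>_def ennreal_plus ennreal_mult)
        finally show ?thesis by (simp add: add_increasing add.assoc)
      qed
    qed
    have \<psi>: "(\<integral>\<^sup>+y. \<psi> y \<partial>lborel) \<le> ennreal \<delta>"
      using A(1) by (simp add: tail_integral_def \<psi>_def)
    have "(\<integral>\<^sup>+y. g\<^sub>1 (x - y) * g\<^sub>2 y \<partial>lborel)
        \<le> (\<integral>\<^sup>+y. K\<^sub>1 * g\<^sub>2 y + K\<^sub>2 * g\<^sub>1 (x - y) + K\<^sub>3 * \<psi> y + K\<^sub>3 * \<psi> (x - y) \<partial>lborel)"
      by (intro nn_integral_mono ptw)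
    also have "\<dots> = K\<^sub>1 * (\<integral>\<^sup>+y. g\<^sub>2 y \<partial>lborel) + K\<^sub>2 * (\<integral>\<^sup>+y. g\<^sub>1 (x - y) \<partial>lborel)
        + K\<^sub>3 * (\<integral>\<^sup>+y. \<psi> y \<partial>lborel) + K\<^sub>3 * (\<integral>\<^sup>+y. \<psi> (x - y) \<partial>lborel)"
      by (simp add: nn_integral_add nn_integral_cmult)
    also have "\<dots> = K\<^sub>1 * (\<integral>\<^sup>+y. g\<^sub>2 y \<partial>lborel) + K\<^sub>2 * (\<integral>\<^sup>+y. g\<^sub>1 y \<partial>lborel)
        + K\<^sub>3 * (\<integral>\<^sup>+y. \<psi> y \<partial>lborel) + K\<^sub>3 * (\<integral>\<^sup>+y. \<psi> y \<partial>lborel)"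
      by (simp add: nn_integral_lborel_reflect)
    also have "\<dots> \<le> ennreal K\<^sub>1 * 1 + ennreal K\<^sub>2 * 1 + K\<^sub>3 * ennreal \<delta> + K\<^sub>3 * ennreal \<delta>"
      by (rule add_mono[OF add_mono[OF add_mono[OF mult_left_mono[OF int(2)] mult_left_mono[OF int(1)]]
          mult_left_mono[OF \<psi>]] mult_left_mono[OF \<psi>]]) simp_all
    also have "\<dots> = ennreal (K\<^sub>1 + K\<^sub>2 + K\<^sub>3 * \<delta> + K\<^sub>3 * \<delta>)"
      using K_nonneg \<open>0 < \<delta>\<close> by (simp flip: ennreal_plus ennreal_mult)
    also have "K\<^sub>1 + K\<^sub>2 + K\<^sub>3 * \<delta> + K\<^sub>3 * \<delta> = ((a + \<delta>) * (1 + \<delta>) + (b + \<delta>) * (1 + \<delta>) + (a + \<delta>) * (b + \<delta>) * \<delta> + (a + \<delta>) * (b + \<delta>) * \<delta>) * ?W x"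
      by (simp add: K algebra_simps)
    also have "ennreal \<dots> \<le> ennreal (\<kappa> * ?W x)"
      using \<delta> by (intro ennreal_leI mult_right_mono) auto
    finally show ?case .
  qed
qed

context prob_space
begin

lemma distributed_nn_integral_eq_1:
  assumes "distributed M lborel Y g"
  shows "(\<integral>\<^sup>+y. g y \<partial>lborel) = 1"
  using distributed_emeasure[OF assms, of UNIV] emeasure_space_1 by simp

lemma distributed_emeasure_greaterThan:
  fixes Y :: "'a \<Rightarrow> real"
  assumes "distributed M lborel Y g"
  shows "emeasure M {\<omega> \<in> space M. Y \<omega> > x} = tail_integral g x"
proof -
  have "{\<omega> \<in> space M. Y \<omega> > x} = Y -` {x<..} \<inter> space M" by auto
  thus ?thesis
    using distributed_emeasure[OF assms, of "{x<..}"] by (simp add: tail_integral_def)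
qed

text \<open>Induction on \<open>I\<close>: independence makes the density of the sum a convolution,
  and the constants add. The induction starts from a singleton because an empty sum has no
  density.\<close>

lemma sum_density_asymp_dominated:
  fixes Y :: "'i \<Rightarrow> 'a \<Rightarrow> real"
  assumes par: "p \<ge> 0" "c > 0" "0 < \<gamma>" "\<gamma> < 1"
    and "finite I" "I \<noteq> {}" "indep_vars (\<lambda>_. borel) Y I"
    and "\<And>i. i \<in> I \<Longrightarrow> distributed M lborel (Y i) (g i)"
    and "\<And>i. i \<in> I \<Longrightarrow> \<alpha> i \<ge> 0"
    and "\<And>i. i \<in> I \<Longrightarrow> asymp_dominated (weibull_weight p c \<gamma>) (\<alpha> i) (g i)"
  shows "\<exists>G. distributed M lborel (\<lambda>\<omega>. \<Sum>i\<in>I. Y i \<omega>) G \<and>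
    asymp_dominated (weibull_weight p c \<gamma>) (\<Sum>i\<in>I. \<alpha> i) G"
  using assms(5-)
proof (induction rule: finite_ne_induct)
  case (singleton i)
  thus ?case by auto
next
  case (insert i I)
  have "indep_vars (\<lambda>_. borel) Y I"
    using insert.prems(1) by (rule indep_vars_subset) auto
  then obtain G where G: "distributed M lborel (\<lambda>\<omega>. \<Sum>i\<in>I. Y i \<omega>) G"
      "asymp_dominated (weibull_weight p c \<gamma>) (\<Sum>i\<in>I. \<alpha> i) G"
    using insert by auto
  have gi: "distributed M lborel (Y i) (g i)" using insert by auto
  have "distributed M lborel (\<lambda>\<omega>. Y i \<omega> + (\<Sum>i\<in>I. Y i \<omega>)) (\<lambda>x. \<integral>\<^sup>+y. g i (x - y) * G y \<partial>lborel)"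
    using insert by (intro distributed_convolution indep_vars_sum gi G) auto
  moreover have "asymp_dominated (weibull_weight p c \<gamma>) (\<alpha> i + (\<Sum>i\<in>I. \<alpha> i))
      (\<lambda>x. \<integral>\<^sup>+y. g i (x - y) * G y \<partial>lborel)"
    using insert.prems distributed_borel_measurable[OF gi] distributed_borel_measurable[OF G(1)]
    by (intro asymp_dominated_convolution par G sum_nonneg)
       (auto simp: distributed_nn_integral_eq_1[OF gi] distributed_nn_integral_eq_1[OF G(1)])
  ultimately show ?case using insert by auto
qed

end

section \<open>Tails of the weight as the scale for tail probabilities\<close>

text \<open>This incomplete gamma integral is never evaluated: upper and lower bounds are both
  expressed as multiples of it. \<open>enn2real\<close> would send an infinite tail to 0, but for
  large \<open>x\<close> the tail is finite.\<close>

definition weibull_tail :: "real \<Rightarrow> real \<Rightarrow> real \<Rightarrow> real \<Rightarrow> real" where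
  "weibull_tail p c \<gamma> x = enn2real (tail_integral (\<lambda>t. ennreal (weibull_weight p c \<gamma> t)) x)"

lemma weibull_tail_nonneg [simp]: "0 \<le> weibull_tail p c \<gamma> x"
  by (simp add: weibull_tail_def)

lemma eventually_ennreal_weibull_tail:
  assumes "c > 0" "\<gamma> > 0"
  shows "\<forall>\<^sub>F x in at_top. tail_integral (\<lambda>t. ennreal (weibull_weight p c \<gamma> t)) x = ennreal (weibull_tail p c \<gamma> x)"
  using tail_integral_weibull_weight[OF assms zero_less_one, of p]
proof eventually_elim
  case (elim x)
  hence "tail_integral (\<lambda>t. ennreal (weibull_weight p c \<gamma> t)) x < top"
    by (rule le_less_trans) simp
  thus ?case by (simp add: weibull_tail_def)
qed

lemma tail_integral_cmult:
  assumes [measurable]: "g \<in> borel_measurable borel"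
  shows "tail_integral (\<lambda>t. a * g t) x = a * tail_integral g x"
  unfolding tail_integral_def by (simp add: nn_integral_cmult mult.assoc)

lemma eventually_tail_integral_scaled:
  assumes "c > 0" "\<gamma> > 0" "\<kappa> \<ge> 0"
  shows "\<forall>\<^sub>F x in at_top. tail_integral (\<lambda>t. ennreal (\<kappa> * weibull_weight p c \<gamma> t)) x = ennreal (\<kappa> * weibull_tail p c \<gamma> x)"
  using eventually_ennreal_weibull_tail[OF assms(1,2), of p]
proof (rule eventually_mono)
  fix x assume elim: "tail_integral (\<lambda>t. ennreal (weibull_weight p c \<gamma> t)) x = ennreal (weibull_tail p c \<gamma> x)"
  have "tail_integral (\<lambda>t. ennreal (\<kappa> * weibull_weight p c \<gamma> t)) x
      = tail_integral (\<lambda>t. ennreal \<kappa> * ennreal (weibull_weight p c \<gamma> t)) x"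
    using assms by (simp add: ennreal_mult)
  also have "\<dots> = ennreal \<kappa> * ennreal (weibull_tail p c \<gamma> x)"
    by (subst tail_integral_cmult) (auto simp: elim)
  finally show "tail_integral (\<lambda>t. ennreal (\<kappa> * weibull_weight p c \<gamma> t)) x = ennreal (\<kappa> * weibull_tail p c \<gamma> x)"
    using assms by (simp add: ennreal_mult)
qed

text \<open>Positivity permits division by the tail. A vanishing integral would force the strictly
  positive weight to vanish almost everywhere on an interval of length 1.\<close>

lemma eventually_weibull_tail_pos:
  assumes "c > 0" "\<gamma> > 0"
  shows "\<forall>\<^sub>F x in at_top. weibull_tail p c \<gamma> x > 0"
  using eventually_ennreal_weibull_tail[OF assms, of p] eventually_gt_at_top[of 0]
proof eventually_elim
  case (elim x)
  have "tail_integral (\<lambda>t. ennreal (weibull_weight p c \<gamma> t)) x \<noteq> 0"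
  proof
    assume "tail_integral (\<lambda>t. ennreal (weibull_weight p c \<gamma> t)) x = 0"
    hence "AE t in lborel. ennreal (weibull_weight p c \<gamma> t) * indicator {x<..} t = 0"
      unfolding tail_integral_def by (subst (asm) nn_integral_0_iff_AE) auto
    hence "AE t in lborel. t \<notin> {x<..<x+1}"
    proof eventually_elim
      case (elim t)
      thus ?case using weibull_weight_pos[of t p c \<gamma>] \<open>0 < x\<close>
        by (auto simp: ennreal_eq_0_iff)
    qed
    hence "emeasure lborel {x<..<x+1} = 0"
      by (subst (asm) AE_iff_measurable[of "{x<..<x+1}"]) auto
    thus False by simp
  qed
  with elim show ?case by (auto simp: less_le)
qed

text \<open>A strictly larger rate beats every constant, since the integrands differ by the factor
  \<open>exp (- (c\<^sub>1 - c\<^sub>2) * t powr \<gamma>)\<close>. This is the source of the limit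
  0 in part (i).\<close>

lemma weibull_tail_dominated:
  assumes "0 < c\<^sub>2" "c\<^sub>2 < c\<^sub>1" "\<gamma> > 0" "\<delta> > 0"
  shows "\<forall>\<^sub>F x in at_top. weibull_tail p c\<^sub>1 \<gamma> x \<le> \<delta> * weibull_tail p c\<^sub>2 \<gamma> x"
proof -
  have "c\<^sub>1 - c\<^sub>2 > 0" using assms by simp
  hence "((\<lambda>x. exp (- (c\<^sub>1 - c\<^sub>2) * x powr \<gamma>)) \<longlongrightarrow> 0) at_top"
    using assms(3) by real_asymp
  hence "\<forall>\<^sub>F x in at_top. exp (- (c\<^sub>1 - c\<^sub>2) * x powr \<gamma>) < \<delta>"
    by (rule order_tendstoD) (rule assms)
  hence "\<forall>\<^sub>F t in at_top. ennreal (1 * weibull_weight p c\<^sub>1 \<gamma> t) \<le> ennreal (\<delta> * weibull_weight p c\<^sub>2 \<gamma> t)"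
  proof eventually_elim
    case (elim t)
    have "weibull_weight p c\<^sub>1 \<gamma> t = exp (- (c\<^sub>1 - c\<^sub>2) * t powr \<gamma>) * weibull_weight p c\<^sub>2 \<gamma> t"
      by (simp add: weibull_weight_def algebra_simps flip: exp_add)
    also have "\<dots> \<le> \<delta> * weibull_weight p c\<^sub>2 \<gamma> t"
      using elim by (intro mult_right_mono) auto
    finally show ?case by (simp add: ennreal_leI)
  qed
  hence "\<forall>\<^sub>F x in at_top. tail_integral (\<lambda>t. ennreal (1 * weibull_weight p c\<^sub>1 \<gamma> t)) x
      \<le> tail_integral (\<lambda>t. ennreal (\<delta> * weibull_weight p c\<^sub>2 \<gamma> t)) x"
    by (rule eventually_tail_integral_mono)
  moreover have "\<forall>\<^sub>F x in at_top. tail_integral (\<lambda>t. ennreal (1 * weibull_weight p c\<^sub>1 \<gamma> t)) x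
      = ennreal (1 * weibull_tail p c\<^sub>1 \<gamma> x)"
    using assms by (intro eventually_tail_integral_scaled) auto
  moreover have "\<forall>\<^sub>F x in at_top. tail_integral (\<lambda>t. ennreal (\<delta> * weibull_weight p c\<^sub>2 \<gamma> t)) x
      = ennreal (\<delta> * weibull_tail p c\<^sub>2 \<gamma> x)"
    using assms by (intro eventually_tail_integral_scaled) auto
  ultimately show ?thesis
  proof eventually_elim
    case (elim x)
    thus ?case using assms by (simp add: ennreal_le_iff)
  qed
qed

context prob_space
begin

lemma prob_greaterThan_le:
  fixes Y :: "'a \<Rightarrow> real"
  assumes Y: "distributed M lborel Y g" and "c > 0" "\<gamma> > 0" "\<kappa> \<ge> 0"
    and "\<forall>\<^sub>F t in at_top. g t \<le> ennreal (\<kappa> * weibull_weight p c \<gamma> t)"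
  shows "\<forall>\<^sub>F x in at_top. prob {\<omega> \<in> space M. Y \<omega> > x} \<le> \<kappa> * weibull_tail p c \<gamma> x"
  using eventually_tail_integral_mono[OF assms(5)] eventually_tail_integral_scaled[OF assms(2-4), of p]
proof eventually_elim
  case (elim x)
  hence "ennreal (prob {\<omega> \<in> space M. Y \<omega> > x}) \<le> ennreal (\<kappa> * weibull_tail p c \<gamma> x)"
    by (simp flip: emeasure_eq_measure add: distributed_emeasure_greaterThan[OF Y])
  thus ?case using assms(4) by (simp add: ennreal_le_iff)
qed

lemma prob_greaterThan_ge:
  fixes Y :: "'a \<Rightarrow> real"
  assumes Y: "distributed M lborel Y g" and "c > 0" "\<gamma> > 0" "\<kappa> \<ge> 0"
    and "\<forall>\<^sub>F t in at_top. ennreal (\<kappa> * weibull_weight p c \<gamma> t) \<le> g t"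
  shows "\<forall>\<^sub>F x in at_top. \<kappa> * weibull_tail p c \<gamma> x \<le> prob {\<omega> \<in> space M. Y \<omega> > x}"
  using eventually_tail_integral_mono[OF assms(5)] eventually_tail_integral_scaled[OF assms(2-4), of p]
proof eventually_elim
  case (elim x)
  hence "ennreal (\<kappa> * weibull_tail p c \<gamma> x) \<le> ennreal (prob {\<omega> \<in> space M. Y \<omega> > x})"
    by (simp flip: emeasure_eq_measure add: distributed_emeasure_greaterThan[OF Y])
  thus ?case by (simp add: ennreal_le_iff)
qed

lemma prob_sum_greaterThan_le:
  fixes Y :: "'i \<Rightarrow> 'a \<Rightarrow> real"
  assumes par: "p \<ge> 0" "c > 0" "0 < \<gamma>" "\<gamma> < 1"
    and I: "finite I" "I \<noteq> {}" "indep_vars (\<lambda>_. borel) Y I"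
    and g: "\<And>i. i \<in> I \<Longrightarrow> distributed M lborel (Y i) (g i)"
    and \<alpha>: "\<And>i. i \<in> I \<Longrightarrow> \<alpha> i \<ge> 0"
    and dom: "\<And>i. i \<in> I \<Longrightarrow> asymp_dominated (weibull_weight p c \<gamma>) (\<alpha> i) (g i)"
    and \<kappa>: "(\<Sum>i\<in>I. \<alpha> i) < \<kappa>"
  shows "\<forall>\<^sub>F x in at_top. prob {\<omega> \<in> space M. (\<Sum>i\<in>I. Y i \<omega>) > x} \<le> \<kappa> * weibull_tail p c \<gamma> x"
proof -
  obtain G where G: "distributed M lborel (\<lambda>\<omega>. \<Sum>i\<in>I. Y i \<omega>) G"
      "asymp_dominated (weibull_weight p c \<gamma>) (\<Sum>i\<in>I. \<alpha> i) G"
    using sum_density_asymp_dominated[OF par I g \<alpha> dom] by blast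
  have "\<kappa> \<ge> 0" using \<kappa> sum_nonneg[of I \<alpha>] \<alpha> by simp
  with G \<kappa> par show ?thesis
    by (intro prob_greaterThan_le[OF G(1)]) (auto simp: asymp_dominated_def)
qed

end

section \<open>Densities of scaled variables\<close>

lemma asymp_dominated_of_tendsto:
  assumes "((\<lambda>x. g x / weibull_weight p c \<gamma> x) \<longlongrightarrow> \<alpha>) at_top"
  shows "asymp_dominated (weibull_weight p c \<gamma>) \<alpha> (\<lambda>x. ennreal (g x))"
  unfolding asymp_dominated_def
proof (intro allI impI)
  fix \<kappa> assume "\<alpha> < \<kappa>"
  with assms have "\<forall>\<^sub>F x in at_top. g x / weibull_weight p c \<gamma> x < \<kappa>"
    by (rule order_tendstoD)
  thus "\<forall>\<^sub>F x in at_top. ennreal (g x) \<le> ennreal (\<kappa> * weibull_weight p c \<gamma> x)"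
    using eventually_gt_at_top[of 0]
  proof eventually_elim
    case (elim x)
    thus ?case using weibull_weight_pos[of x p c \<gamma>] by (intro ennreal_leI) (simp add: field_simps)
  qed
qed

lemma eventually_ge_of_tendsto:
  assumes "((\<lambda>x. g x / weibull_weight p c \<gamma> x) \<longlongrightarrow> \<alpha>) at_top" "\<kappa> < \<alpha>"
  shows "\<forall>\<^sub>F x in at_top. ennreal (\<kappa> * weibull_weight p c \<gamma> x) \<le> ennreal (g x)"
  using order_tendstoD(1)[OF assms] eventually_gt_at_top[of 0]
proof eventually_elim
  case (elim x)
  thus ?case using weibull_weight_pos[of x p c \<gamma>] by (intro ennreal_leI) (simp add: field_simps)
qed

text \<open>Scaling a variable by \<open>a\<close> divides the rate by
  \<open>a powr \<gamma>\<close>, so the largest coefficient has the smallest rate and hence the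
  heaviest tail.\<close>

lemma weibull_weight_scale:
  assumes "0 < x" "0 < a"
  shows "weibull_weight p c \<gamma> (x / a) = a powr - p * weibull_weight p (c / a powr \<gamma>) \<gamma> x"
  using assms by (simp add: weibull_weight_def powr_divide powr_minus field_simps)

lemma weibull_weight_rate_ratio:
  assumes "c\<^sub>1 > c\<^sub>2" "\<gamma> > 0"
  shows "((\<lambda>x. weibull_weight p c\<^sub>1 \<gamma> x / weibull_weight p c\<^sub>2 \<gamma> x) \<longlongrightarrow> 0) at_top"
proof -
  have "c\<^sub>1 - c\<^sub>2 > 0" using assms by simp
  hence *: "((\<lambda>x. exp (- (c\<^sub>1 - c\<^sub>2) * x powr \<gamma>)) \<longlongrightarrow> 0) at_top"
    using assms(2) by real_asymp
  have "\<forall>\<^sub>F x in at_top. exp (- (c\<^sub>1 - c\<^sub>2) * x powr \<gamma>) = weibull_weight p c\<^sub>1 \<gamma> x / weibull_weight p c\<^sub>2 \<gamma> x"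
    using eventually_gt_at_top[of 0]
    by eventually_elim (simp add: weibull_weight_def field_simps flip: exp_add exp_diff)
  with * show ?thesis by (rule Lim_transform_eventually)
qed

text \<open>The function compared is the density of \<open>a\<close> times the noise, minus
  \<open>b\<close>. The ratio is a product of three factors: \<open>f\<close> against its asymptotic
  form, removal of the shift, and the rate for \<open>a\<close> against the rate for
  \<open>m\<close>. The last tends to 0 if \<open>a < m\<close>. In the exponent
  \<open>- 1 - p\<close>, the 1 is the Jacobian and the \<open>p\<close> comes from scaling the
  power.\<close>

lemma scaled_density_ratio:
  assumes f: "f \<sim>[at_top] (\<lambda>x. C\<^sub>1 * x powr p * exp (- C * x powr \<gamma>))"
    and "C > 0" "C\<^sub>1 > 0" "0 < \<gamma>" "\<gamma> < 1" "0 < a" "a \<le> m"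
  shows "((\<lambda>x. f ((x + b) / a) / a / weibull_weight p (C / m powr \<gamma>) \<gamma> x)
    \<longlongrightarrow> (if a = m then C\<^sub>1 * m powr (- 1 - p) else 0)) at_top"
proof -
  let ?W = "\<lambda>c. weibull_weight p c \<gamma>"
  \<comment> \<open>Asymptotic equivalence treats 0/0 as 1; the comparison function is positive for
    positive \<open>x\<close>, so an ordinary limit of ratios results.\<close>
  have "((\<lambda>x. f x / (C\<^sub>1 * x powr p * exp (- C * x powr \<gamma>))) \<longlongrightarrow> 1) at_top"
    using f by (rule asymp_equivD_strong, intro eventually_mono[OF eventually_gt_at_top[of 0]])
      (use assms in auto)
  hence "((\<lambda>x. f x / (C\<^sub>1 * ?W C x)) \<longlongrightarrow> 1) at_top"
    by (simp add: weibull_weight_def mult.assoc)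
  moreover have "filterlim (\<lambda>x. (x + b) / a) at_top at_top"
    using assms by real_asymp
  ultimately have 1: "((\<lambda>x. f ((x + b) / a) / (C\<^sub>1 * ?W C ((x + b) / a))) \<longlongrightarrow> 1) at_top"
    by (rule filterlim_compose)
  have 2: "((\<lambda>x. ?W (C / a powr \<gamma>) (x + b) / ?W (C / a powr \<gamma>) x) \<longlongrightarrow> 1) at_top"
    by (intro weibull_weight_shift assms)
  have 3: "((\<lambda>x. ?W (C / a powr \<gamma>) x / ?W (C / m powr \<gamma>) x) \<longlongrightarrow> (if a = m then 1 else 0)) at_top"
  proof (cases "a = m")
    case True
    have "((\<lambda>x. ?W (C / m powr \<gamma>) x / ?W (C / m powr \<gamma>) x) \<longlongrightarrow> 1) at_top"
      by (rule tendsto_eventually, rule eventually_mono[OF eventually_gt_at_top[of 0]])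
         (use weibull_weight_pos[of _ p "C / m powr \<gamma>" \<gamma>] in force)
    thus ?thesis using True by simp
  next
    case False
    hence "C / m powr \<gamma> < C / a powr \<gamma>"
      using assms by (intro divide_strict_left_mono powr_less_mono2) auto
    with False assms weibull_weight_rate_ratio show ?thesis by auto
  qed
  have "((\<lambda>x. (C\<^sub>1 * a powr - p / a) * (f ((x + b) / a) / (C\<^sub>1 * ?W C ((x + b) / a)) *
      (?W (C / a powr \<gamma>) (x + b) / ?W (C / a powr \<gamma>) x) * (?W (C / a powr \<gamma>) x / ?W (C / m powr \<gamma>) x)))
      \<longlongrightarrow> (C\<^sub>1 * a powr - p / a) * (1 * 1 * (if a = m then 1 else 0))) at_top"
    by (intro tendsto_mult[OF tendsto_const] tendsto_mult 1 2 3)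
  moreover have "(C\<^sub>1 * a powr - p / a) * (1 * 1 * (if a = m then 1 else 0))
      = (if a = m then C\<^sub>1 * m powr (- 1 - p) else 0)"
    using assms by (auto simp: powr_diff powr_minus field_simps)
  moreover have "\<forall>\<^sub>F x in at_top. (C\<^sub>1 * a powr - p / a) * (f ((x + b) / a) / (C\<^sub>1 * ?W C ((x + b) / a)) *
      (?W (C / a powr \<gamma>) (x + b) / ?W (C / a powr \<gamma>) x) * (?W (C / a powr \<gamma>) x / ?W (C / m powr \<gamma>) x))
      = f ((x + b) / a) / a / ?W (C / m powr \<gamma>) x"
    using eventually_gt_at_top[of 0] eventually_gt_at_top[of "-b"]
  proof eventually_elim
    case (elim x)
    have pos: "?W (C / a powr \<gamma>) (x + b) > 0" "?W (C / a powr \<gamma>) x > 0" "?W (C / m powr \<gamma>) x > 0"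
      using elim by (auto intro!: weibull_weight_pos)
    have "?W C ((x + b) / a) = a powr - p * ?W (C / a powr \<gamma>) (x + b)"
      using elim assms by (intro weibull_weight_scale) auto
    moreover have "a powr - p > 0" using assms by simp
    ultimately show ?case using pos assms by (simp add: field_simps)
  qed
  ultimately show ?thesis by (simp add: Lim_transform_eventually)
qed

text \<open>The strict inequality for \<open>s\<close> leaves the positive margin
  \<open>C - s * a powr \<gamma>\<close>, which absorbs \<open>h\<close>, being o(x^gamma). The
  constant \<open>1 / a\<close> is the Jacobian.\<close>

lemma stretched_exp_density_le:
  assumes h: "h \<in> o[at_top](\<lambda>x. x powr \<gamma>)"
    and f: "\<forall>\<^sub>F x in at_top. f x = exp (h x) * exp (- C * x powr \<gamma>)"
    and "0 < \<gamma>" "0 < a" "s < C / a powr \<gamma>"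
  shows "asymp_dominated (weibull_weight 0 s \<gamma>) (1 / a) (\<lambda>x. ennreal (f (x / a) / a))"
proof -
  have s: "C - s * a powr \<gamma> > 0" using assms by (simp add: field_simps)
  have lim: "filterlim (\<lambda>x. x / a) at_top at_top" using assms by real_asymp
  have "\<forall>\<^sub>F x in at_top. ennreal (f (x / a) / a) \<le> ennreal (1 / a * weibull_weight 0 s \<gamma> x)"
    using eventually_compose_filterlim[OF landau_o.smallD[OF h s] lim]
      eventually_compose_filterlim[OF f lim] eventually_gt_at_top[of 0]
  proof eventually_elim
    case (elim x)
    have "h (x / a) - C * (x / a) powr \<gamma> \<le> - s * (a powr \<gamma> * (x / a) powr \<gamma>)"
      using elim by (auto simp: algebra_simps)
    also have "a powr \<gamma> * (x / a) powr \<gamma> = x powr \<gamma>"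
      using elim assms by (simp add: powr_divide)
    finally have "exp (h (x / a) - C * (x / a) powr \<gamma>) \<le> exp (- s * x powr \<gamma>)" by simp
    moreover have "f (x / a) = exp (h (x / a) - C * (x / a) powr \<gamma>)"
      using elim by (simp flip: exp_add)
    ultimately have "f (x / a) \<le> weibull_weight 0 s \<gamma> x"
      using elim by (simp add: weibull_weight_def)
    thus ?case using assms by (intro ennreal_leI) (simp add: divide_right_mono)
  qed
  thus ?thesis unfolding asymp_dominated_def
  proof (intro allI impI, elim eventually_mono)
    fix \<kappa> x assume "1 / a < \<kappa>" and *: "ennreal (f (x / a) / a) \<le> ennreal (1 / a * weibull_weight 0 s \<gamma> x)"
    note *
    also have "ennreal (1 / a * weibull_weight 0 s \<gamma> x) \<le> ennreal (\<kappa> * weibull_weight 0 s \<gamma> x)"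
      using \<open>1 / a < \<kappa>\<close> by (intro ennreal_leI mult_right_mono) auto
    finally show "ennreal (f (x / a) / a) \<le> ennreal (\<kappa> * weibull_weight 0 s \<gamma> x)" .
  qed
qed

text \<open>The mirror image, with margin \<open>s * a powr \<gamma> - C\<close>. The additional
  factor 1/2 pays for replacing \<open>x + b\<close> by \<open>x\<close> in the weight.\<close>

lemma stretched_exp_density_ge:
  assumes h: "h \<in> o[at_top](\<lambda>x. x powr \<gamma>)"
    and f: "\<forall>\<^sub>F x in at_top. f x = exp (h x) * exp (- C * x powr \<gamma>)"
    and "0 < \<gamma>" "\<gamma> < 1" "0 < a" "C / a powr \<gamma> < s"
  shows "\<forall>\<^sub>F x in at_top. ennreal (1 / (2 * a) * weibull_weight 0 s \<gamma> x) \<le> ennreal (f ((x + b) / a) / a)"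
proof -
  have s: "s * a powr \<gamma> - C > 0" using assms by (simp add: field_simps)
  have lim: "filterlim (\<lambda>x. (x + b) / a) at_top at_top" using assms by real_asymp
  have "\<forall>\<^sub>F x in at_top. weibull_weight 0 s \<gamma> (x + b) / weibull_weight 0 s \<gamma> x > 1 / 2"
    using weibull_weight_shift[OF assms(3,4)] by (rule order_tendstoD) simp
  thus ?thesis
    using eventually_compose_filterlim[OF landau_o.smallD[OF h s] lim]
      eventually_compose_filterlim[OF f lim] eventually_gt_at_top[of 0] eventually_gt_at_top[of "-b"]
  proof eventually_elim
    case (elim x)
    have "h ((x + b) / a) - C * ((x + b) / a) powr \<gamma> \<ge> - s * (a powr \<gamma> * ((x + b) / a) powr \<gamma>)"
      using elim by (auto simp: algebra_simps)
    also have "a powr \<gamma> * ((x + b) / a) powr \<gamma> = (x + b) powr \<gamma>"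
      using elim assms by (simp add: powr_divide)
    finally have "exp (h ((x + b) / a) - C * ((x + b) / a) powr \<gamma>) \<ge> exp (- s * (x + b) powr \<gamma>)" by simp
    moreover have "f ((x + b) / a) = exp (h ((x + b) / a) - C * ((x + b) / a) powr \<gamma>)"
      using elim by (simp flip: exp_add)
    ultimately have "f ((x + b) / a) \<ge> weibull_weight 0 s \<gamma> (x + b)"
      using elim by (simp add: weibull_weight_def)
    moreover have "weibull_weight 0 s \<gamma> x \<le> 2 * weibull_weight 0 s \<gamma> (x + b)"
      using elim weibull_weight_pos[of x 0 s \<gamma>] by (simp add: field_simps)
    ultimately have "weibull_weight 0 s \<gamma> x \<le> 2 * f ((x + b) / a)" by linarith
    thus ?case using assms by (intro ennreal_leI) (simp add: field_simps)
  qed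
qed

section \<open>Squeezing a ratio, affine images, and one large variable among bounded ones\<close>

text \<open>Both functions are compared with a common scale \<open>t\<close>. For \<kappa> < 1, the
  bounds with \<kappa> and 1/\<kappa> together give u/v \<ge> \<kappa>^2.\<close>

lemma tendsto_divide_1_of_bounds:
  fixes t u v :: "real \<Rightarrow> real"
  assumes t: "\<forall>\<^sub>F x in F. t x > 0"
    and le: "\<And>x. u x \<le> v x"
    and u: "\<And>\<kappa>. 0 < \<kappa> \<Longrightarrow> \<kappa> < 1 \<Longrightarrow> \<forall>\<^sub>F x in F. \<kappa> * t x \<le> u x"
    and v: "\<And>\<kappa>. 1 < \<kappa> \<Longrightarrow> \<forall>\<^sub>F x in F. v x \<le> \<kappa> * t x"
  shows "((\<lambda>x. u x / v x) \<longlongrightarrow> 1) F"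
proof (rule order_tendstoI)
  fix a :: real assume "a < 1"
  \<comment> \<open>For 0 < a < 1 the square of (1 + a)/2 exceeds \<open>a\<close> by AM-GM; the
    maximum with 1/2 keeps \<open>\<kappa>\<close> positive for negative \<open>a\<close>.\<close>
  define \<kappa> where "\<kappa> = max (1 / 2) ((1 + a) / 2)"
  have \<kappa>: "0 < \<kappa>" "\<kappa> < 1" using \<open>a < 1\<close> by (auto simp: \<kappa>_def)
  have "a < \<kappa>\<^sup>2"
  proof (cases "a \<le> 0")
    case True
    moreover have "0 < \<kappa>\<^sup>2" using \<kappa> by simp
    ultimately show ?thesis by linarith
  next
    case False
    have "a < ((1 + a) / 2)\<^sup>2"
      using \<open>a < 1\<close> zero_less_power2[of "1 - a"] by (simp add: power2_eq_square field_simps)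
    also have "\<dots> \<le> \<kappa>\<^sup>2" using False by (intro power_mono) (auto simp: \<kappa>_def)
    finally show ?thesis .
  qed
  have "1 < 1 / \<kappa>" using \<kappa> by simp
  from t u[OF \<kappa>] v[OF this] show "\<forall>\<^sub>F x in F. a < u x / v x"
  proof eventually_elim
    case (elim x)
    have "0 < u x" using elim \<kappa> by (auto intro: less_le_trans[OF mult_pos_pos])
    hence "0 < v x" using le[of x] by simp
    have "\<kappa>\<^sup>2 * v x \<le> \<kappa>\<^sup>2 * (1 / \<kappa> * t x)" using elim by (intro mult_left_mono) auto
    also have "\<dots> = \<kappa> * t x" using \<kappa> by (simp add: power2_eq_square)
    also have "\<dots> \<le> u x" by (rule elim)
    finally have "\<kappa>\<^sup>2 \<le> u x / v x" using \<open>0 < v x\<close> by (simp add: pos_le_divide_eq)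
    with \<open>a < \<kappa>\<^sup>2\<close> show ?case by simp
  qed
next
  fix a :: real assume "1 < a"
  show "\<forall>\<^sub>F x in F. u x / v x < a"
    \<comment> \<open>Any constant in (0, 1) would do: the bound only serves to make
      \<open>u x\<close>, and thus \<open>v x\<close>, positive.\<close>
    using t u[of "1 / 2", simplified]
  proof eventually_elim
    case (elim x)
    have "u x / v x \<le> 1" using elim le[of x] by (auto simp: divide_le_eq_1)
    thus ?case using \<open>1 < a\<close> by simp
  qed
qed

context prob_space
begin

text \<open>The shift \<open>b\<close> later absorbs the bounded contribution of the remaining terms
  of the moving average.\<close>

lemma distributed_scaled:
  fixes Y :: "'a \<Rightarrow> real"
  assumes "distributed M lborel Y (\<lambda>x. ennreal (f x))" "0 < a"
  shows "distributed M lborel (\<lambda>\<omega>. a * Y \<omega> - b) (\<lambda>x. ennreal (f ((x + b) / a) / a))"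
proof -
  have "distributed M lborel (\<lambda>\<omega>. - b + a * Y \<omega>) (\<lambda>x. ennreal (f ((x - - b) / a)) / ennreal \<bar>a\<bar>)"
    using assms by (intro distributed_affine) auto
  \<comment> \<open>For negative \<open>u\<close> both sides are 0, as \<open>ennreal\<close>
    truncates.\<close>
  moreover have "ennreal u / ennreal a = ennreal (u / a)" for u
    using \<open>0 < a\<close> by (cases "u \<ge> 0") (auto simp: divide_ennreal ennreal_neg divide_nonpos_pos)
  ultimately show ?thesis using \<open>0 < a\<close> by simp
qed

lemma prob_abs_le_tendsto_1:
  fixes Y :: "'a \<Rightarrow> real"
  assumes [measurable]: "random_variable borel Y"
  shows "(\<lambda>n. prob {\<omega> \<in> space M. \<bar>Y \<omega>\<bar> \<le> real n}) \<longlonglongrightarrow> 1"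
proof -
  have "(\<lambda>n. prob {\<omega> \<in> space M. \<bar>Y \<omega>\<bar> \<le> real n}) \<longlonglongrightarrow> prob (\<Union>n. {\<omega> \<in> space M. \<bar>Y \<omega>\<bar> \<le> real n})"
    by (rule finite_Lim_measure_incseq) (auto simp: incseq_def)
  also have "(\<Union>n. {\<omega> \<in> space M. \<bar>Y \<omega>\<bar> \<le> real n}) = space M"
    using real_arch_simple by auto
  finally show ?thesis by (simp add: prob_space)
qed

text \<open>By independence the right-hand probability factors. \<open>A\<close> is chosen so that
  the product over all of \<open>J\<close> of the probabilities of staying within \<open>A\<close>
  exceeds \<open>\<kappa>\<close>; omitting the factor of \<open>k\<close> only increases it, so
  \<open>A\<close> works for every \<open>k\<close> and \<open>V\<close> at once.\<close>

lemma prob_one_free_others_bounded: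
  fixes \<epsilon> :: "'i \<Rightarrow> 'a \<Rightarrow> real"
  assumes indep: "indep_vars (\<lambda>_. borel) \<epsilon> UNIV" and J: "finite J" and \<kappa>: "\<kappa> < 1"
  shows "\<exists>A\<ge>0. \<forall>k\<in>J. \<forall>V\<in>sets borel. \<kappa> * prob {\<omega> \<in> space M. \<epsilon> k \<omega> \<in> V}
    \<le> prob {\<omega> \<in> space M. \<epsilon> k \<omega> \<in> V \<and> (\<forall>l\<in>J - {k}. \<bar>\<epsilon> l \<omega>\<bar> \<le> A)}"
proof -
  have [measurable]: "random_variable borel (\<epsilon> i)" for i
    using indep by (auto simp: indep_vars_def)
  have "(\<lambda>n. \<Prod>l\<in>J. prob {\<omega> \<in> space M. \<bar>\<epsilon> l \<omega>\<bar> \<le> real n}) \<longlonglongrightarrow> (\<Prod>l\<in>J. 1)"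
    by (intro tendsto_prod prob_abs_le_tendsto_1) auto
  hence "\<forall>\<^sub>F n in sequentially. (\<Prod>l\<in>J. prob {\<omega> \<in> space M. \<bar>\<epsilon> l \<omega>\<bar> \<le> real n}) > \<kappa>"
    by (rule order_tendstoD) (use \<kappa> in simp)
  then obtain n where n: "(\<Prod>l\<in>J. prob {\<omega> \<in> space M. \<bar>\<epsilon> l \<omega>\<bar> \<le> real n}) > \<kappa>"
    by (auto simp: eventually_sequentially)
  show ?thesis
  proof (intro exI[of _ "real n"] conjI ballI)
    fix k and V :: "real set" assume k: "k \<in> J" and V[measurable]: "V \<in> sets borel"
    let ?p = "\<lambda>l. prob {\<omega> \<in> space M. \<bar>\<epsilon> l \<omega>\<bar> \<le> real n}"
    \<comment> \<open>One Borel set per index puts the event into the product form that independence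
      requires.\<close>
    define U where "U l = (if l = k then V else {- real n..real n})" for l
    have U: "U l \<in> sets borel" for l by (auto simp: U_def)
    have "prob (\<Inter>l\<in>J. \<epsilon> l -` U l \<inter> space M) = (\<Prod>l\<in>J. prob (\<epsilon> l -` U l \<inter> space M))"
      using k J U by (intro indep_varsD[OF indep]) auto
    also have "(\<Inter>l\<in>J. \<epsilon> l -` U l \<inter> space M)
        = {\<omega> \<in> space M. \<epsilon> k \<omega> \<in> V \<and> (\<forall>l\<in>J - {k}. \<bar>\<epsilon> l \<omega>\<bar> \<le> real n)}"
      using k by (auto simp: U_def abs_le_iff split: if_splits) (force simp: minus_le_iff)+
    also have "(\<Prod>l\<in>J. prob (\<epsilon> l -` U l \<inter> space M))
        = prob (\<epsilon> k -` U k \<inter> space M) * (\<Prod>l\<in>J - {k}. prob (\<epsilon> l -` U l \<inter> space M))"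
      using k J by (rule prod.remove[rotated])
    also have "\<epsilon> k -` U k \<inter> space M = {\<omega> \<in> space M. \<epsilon> k \<omega> \<in> V}" by (auto simp: U_def)
    also have "(\<Prod>l\<in>J - {k}. prob (\<epsilon> l -` U l \<inter> space M)) = (\<Prod>l\<in>J - {k}. ?p l)"
      by (intro prod.cong refl arg_cong[where f = prob]) (auto simp: U_def abs_le_iff)
    finally have eq: "prob {\<omega> \<in> space M. \<epsilon> k \<omega> \<in> V \<and> (\<forall>l\<in>J - {k}. \<bar>\<epsilon> l \<omega>\<bar> \<le> real n)}
        = prob {\<omega> \<in> space M. \<epsilon> k \<omega> \<in> V} * (\<Prod>l\<in>J - {k}. ?p l)" .
    have "\<kappa> \<le> ?p k * (\<Prod>l\<in>J - {k}. ?p l)"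
      using n prod.remove[OF J k, of ?p] by simp
    also have "\<dots> \<le> 1 * (\<Prod>l\<in>J - {k}. ?p l)"
      by (intro mult_right_mono prod_nonneg) auto
    finally have "\<kappa> \<le> (\<Prod>l\<in>J - {k}. ?p l)" by simp
    thus "\<kappa> * prob {\<omega> \<in> space M. \<epsilon> k \<omega> \<in> V}
       \<le> prob {\<omega> \<in> space M. \<epsilon> k \<omega> \<in> V \<and> (\<forall>l\<in>J - {k}. \<bar>\<epsilon> l \<omega>\<bar> \<le> real n)}"
      unfolding eq by (subst mult.commute) (intro mult_left_mono, auto)
  qed simp
qed

end

section \<open>Moving averages\<close>

text \<open>Indexing by the noise variables instead of the weights puts several of the averages over
  one common index set \<open>J\<close>, where they can be added coefficientwise.\<close>

lemma moving_average_eq_sum: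
  assumes "finite J" "(\<lambda>l. i + l) ` {k. \<theta> k \<noteq> 0} \<subseteq> J"
  shows "moving_average \<theta> \<epsilon> i \<omega> = (\<Sum>k\<in>J. \<theta> (k - i) * \<epsilon> k \<omega>)"
proof -
  have "moving_average \<theta> \<epsilon> i \<omega> = (\<Sum>k\<in>(\<lambda>l. i + l) ` {k. \<theta> k \<noteq> 0}. \<theta> (k - i) * \<epsilon> k \<omega>)"
    unfolding moving_average_def by (subst sum.reindex) (auto simp: inj_on_def)
  also have "\<dots> = (\<Sum>k\<in>J. \<theta> (k - i) * \<epsilon> k \<omega>)"
  proof (intro sum.mono_neutral_left assms ballI)
    fix k assume "k \<in> J - (\<lambda>l. i + l) ` {k. \<theta> k \<noteq> 0}"
    hence "\<theta> (k - i) = 0" by (auto simp: image_iff dest: spec[of _ "k - i"])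
    thus "\<theta> (k - i) * \<epsilon> k \<omega> = 0" by simp
  qed
  finally show ?thesis .
qed

text \<open>Once the term of \<open>\<epsilon> k\<close> is removed, every remaining term is at most
  \<open>A * \<theta> l\<close> in absolute value.\<close>

lemma moving_average_near_single_term:
  assumes "finite {k. \<theta> k \<noteq> 0}" "\<And>k. \<theta> k \<ge> 0" "0 \<le> A"
    and "\<And>l. \<theta> l \<noteq> 0 \<Longrightarrow> j + l \<noteq> k \<Longrightarrow> \<bar>\<epsilon> (j + l) \<omega>\<bar> \<le> A"
  shows "\<bar>moving_average \<theta> \<epsilon> j \<omega> - \<theta> (k - j) * \<epsilon> k \<omega>\<bar> \<le> A * (\<Sum>l | \<theta> l \<noteq> 0. \<theta> l)"
proof -
  let ?S = "{l. \<theta> l \<noteq> 0}"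
  \<comment> \<open>If \<open>k - j\<close> lies outside the support, both sides are 0.\<close>
  have "\<theta> (k - j) * \<epsilon> k \<omega> = (\<Sum>l\<in>?S. if k - j = l then \<theta> l * \<epsilon> k \<omega> else 0)"
    using assms(1) by (simp add: sum.delta')
  hence "moving_average \<theta> \<epsilon> j \<omega> - \<theta> (k - j) * \<epsilon> k \<omega>
      = (\<Sum>l\<in>?S. \<theta> l * \<epsilon> (j + l) \<omega> - (if k - j = l then \<theta> l * \<epsilon> k \<omega> else 0))"
    by (simp add: moving_average_def sum_subtractf)
  also have "\<bar>\<dots>\<bar> \<le> (\<Sum>l\<in>?S. \<bar>\<theta> l * \<epsilon> (j + l) \<omega> - (if k - j = l then \<theta> l * \<epsilon> k \<omega> else 0)\<bar>)"
    by (rule sum_abs)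
  also have "\<dots> \<le> (\<Sum>l\<in>?S. A * \<theta> l)"
  proof (rule sum_mono)
    fix l assume l: "l \<in> ?S"
    show "\<bar>\<theta> l * \<epsilon> (j + l) \<omega> - (if k - j = l then \<theta> l * \<epsilon> k \<omega> else 0)\<bar> \<le> A * \<theta> l"
    proof (cases "k - j = l")
      case True
      hence "j + l = k" by simp
      with True assms(2,3) show ?thesis by simp
    next
      case False
      hence "\<bar>\<epsilon> (j + l) \<omega>\<bar> \<le> A" using l by (intro assms(4)) auto
      hence "\<theta> l * \<bar>\<epsilon> (j + l) \<omega>\<bar> \<le> \<theta> l * A" using assms(2) by (rule mult_left_mono)
      with False assms(2) show ?thesis by (simp add: abs_mult mult.commute)
    qed
  qed
  finally show ?thesis by (simp add: sum_distrib_left)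
qed

lemma mem_max_indices_iff:
  assumes "k \<in> max_indices \<theta>"
  shows "l \<in> max_indices \<theta> \<longleftrightarrow> \<theta> l = \<theta> k"
  using assms by (auto simp: max_indices_def intro: antisym)

lemma max_indices_pos:
  assumes "k \<in> max_indices \<theta>" "\<And>k. \<theta> k \<ge> (0::real)" "\<exists>k. \<theta> k \<noteq> 0"
  shows "\<theta> k > 0"
  using assms by (auto simp: max_indices_def) (metis order.antisym linorder_not_le order.strict_trans2)

text \<open>When only \<open>\<epsilon> k\<close> is large, the average at \<open>j\<close> differs
  from \<open>\<theta> (k - j) * \<epsilon> k \<omega>\<close> by at most the slack in
  \<open>big\<close> and \<open>low\<close>, so it exceeds \<open>x\<close> exactly when
  \<open>k - j\<close> is a maximal index. The reflection l to k - l then matches these indices with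
  the exceedances.\<close>

lemma exceedance_count_single_big_term:
  assumes fin: "finite {k. \<theta> k \<noteq> 0}" and nonneg: "\<And>k. \<theta> k \<ge> 0"
    and r: "Max {k. \<theta> k \<noteq> 0} - Min {k. \<theta> k \<noteq> 0} \<le> r"
    and k: "k \<in> max_indices \<theta>" "\<theta> k > 0" and "0 \<le> A"
    and small: "\<And>j l. \<bar>j\<bar> \<le> r \<Longrightarrow> \<theta> l \<noteq> 0 \<Longrightarrow> j + l \<noteq> k \<Longrightarrow> \<bar>\<epsilon> (j + l) \<omega>\<bar> \<le> A"
    and big: "\<theta> k * \<epsilon> k \<omega> > x + A * (\<Sum>l | \<theta> l \<noteq> 0. \<theta> l)"
    and low: "\<And>l. \<theta> l < \<theta> k \<Longrightarrow> \<theta> l * \<epsilon> k \<omega> \<le> x - A * (\<Sum>l | \<theta> l \<noteq> 0. \<theta> l)"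
  shows "exceedance_count (moving_average \<theta> \<epsilon>) r x \<omega> = card (max_indices \<theta>)"
    and "moving_average \<theta> \<epsilon> 0 \<omega> > x"
proof -
  \<comment> \<open>Both \<open>k\<close> and \<open>l\<close> lie in the support, whose spread is
    at most \<open>r\<close>; hence every exceedance \<open>j = k - l\<close> falls into the
    counting window.\<close>
  have range: "\<bar>k - l\<bar> \<le> r" if "\<theta> l \<noteq> 0" for l
  proof -
    have "l \<in> {k. \<theta> k \<noteq> 0}" "k \<in> {k. \<theta> k \<noteq> 0}" using that k by auto
    with fin have "Min {k. \<theta> k \<noteq> 0} \<le> l" "l \<le> Max {k. \<theta> k \<noteq> 0}"
        "Min {k. \<theta> k \<noteq> 0} \<le> k" "k \<le> Max {k. \<theta> k \<noteq> 0}"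
      by (meson Min_le Max_ge)+
    with r show ?thesis by linarith
  qed
  have exceeds: "moving_average \<theta> \<epsilon> j \<omega> > x \<longleftrightarrow> k - j \<in> max_indices \<theta>" if "\<bar>j\<bar> \<le> r" for j
  proof -
    have near: "\<bar>moving_average \<theta> \<epsilon> j \<omega> - \<theta> (k - j) * \<epsilon> k \<omega>\<bar> \<le> A * (\<Sum>l | \<theta> l \<noteq> 0. \<theta> l)"
      using fin nonneg \<open>0 \<le> A\<close> small[OF that] by (rule moving_average_near_single_term)
    show ?thesis
    proof (cases "\<theta> (k - j) = \<theta> k")
      case True
      thus ?thesis using near big by (simp add: mem_max_indices_iff[OF k(1)] abs_le_iff)
    next
      case False
      hence "\<theta> (k - j) < \<theta> k" using k(1) by (auto simp: max_indices_def less_le)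
      from low[OF this] near False show ?thesis
        by (simp add: mem_max_indices_iff[OF k(1)] abs_le_iff)
    qed
  qed
  have max_supp: "\<theta> l \<noteq> 0" if "l \<in> max_indices \<theta>" for l
    using that k by (simp add: mem_max_indices_iff[OF k(1)])
  have "{j. \<bar>j\<bar> \<le> r \<and> moving_average \<theta> \<epsilon> j \<omega> > x} = (\<lambda>l. k - l) ` max_indices \<theta>"
  proof (intro equalityI subsetI)
    fix j assume "j \<in> {j. \<bar>j\<bar> \<le> r \<and> moving_average \<theta> \<epsilon> j \<omega> > x}"
    hence "k - j \<in> max_indices \<theta>" using exceeds[of j] by auto
    moreover have "j = k - (k - j)" by simp
    ultimately show "j \<in> (\<lambda>l. k - l) ` max_indices \<theta>" by (rule rev_image_eqI)
  next
    fix j assume "j \<in> (\<lambda>l. k - l) ` max_indices \<theta>"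
    then obtain l where l: "l \<in> max_indices \<theta>" "j = k - l" by auto
    thus "j \<in> {j. \<bar>j\<bar> \<le> r \<and> moving_average \<theta> \<epsilon> j \<omega> > x}"
      using range[OF max_supp[OF l(1)]] exceeds[of j] by simp
  qed
  thus "exceedance_count (moving_average \<theta> \<epsilon>) r x \<omega> = card (max_indices \<theta>)"
    unfolding exceedance_count_def by (simp add: card_image inj_on_def)
  show "moving_average \<theta> \<epsilon> 0 \<omega> > x"
    using exceeds[of 0] range[of k] k by simp
qed

section \<open>Part (i): a unique largest weight\<close>

context prob_space
begin

lemma indep_vars_scaled:
  assumes "indep_vars (\<lambda>_. borel) \<epsilon> UNIV"
  shows "indep_vars (\<lambda>_. borel) (\<lambda>i \<omega>. w i * \<epsilon> i \<omega> :: real) I"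
  using indep_vars_compose2[OF indep_vars_subset[OF assms subset_UNIV], where Y = "\<lambda>i x. w i * x" and N = "\<lambda>_. borel"]
  by simp

text \<open>All weights lie strictly below \<open>m\<close>, so the combination has a tail of some
  rate \<open>s > C / m powr \<gamma>\<close>, while \<open>v\<close> is bounded below at every rate
  above \<open>C / m powr \<gamma>\<close>. A rate between these two makes the ratio vanish.\<close>

lemma prob_linear_combination_ratio_tendsto_0:
  fixes \<epsilon> :: "int \<Rightarrow> 'a \<Rightarrow> real"
  assumes indep: "indep_vars (\<lambda>_. borel) \<epsilon> UNIV"
    and dens: "\<And>i. distributed M lborel (\<epsilon> i) (\<lambda>x. ennreal (f x))"
    and h: "h \<in> o[at_top](\<lambda>x. x powr \<gamma>)"
    and f: "\<forall>\<^sub>F x in at_top. f x = exp (h x) * exp (- C * x powr \<gamma>)"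
    and par: "C > 0" "0 < \<gamma>" "\<gamma> < 1"
    and J: "finite J" "J \<noteq> {}" and w: "\<And>k. k \<in> J \<Longrightarrow> 0 < w k" "\<And>k. k \<in> J \<Longrightarrow> w k < m"
    and v: "\<And>s. s > C / m powr \<gamma> \<Longrightarrow> \<exists>\<kappa>>0. \<forall>\<^sub>F x in at_top. \<kappa> * weibull_tail 0 s \<gamma> x \<le> v x"
    and u: "\<And>x. u x \<le> prob {\<omega> \<in> space M. (\<Sum>k\<in>J. w k * \<epsilon> k \<omega>) > x}" "\<And>x. 0 \<le> u x"
  shows "((\<lambda>x. u x / v x) \<longlongrightarrow> 0) at_top"
proof -
  have "m > 0" using J w by fastforce
  \<comment> \<open>As \<open>J\<close> is finite, a single \<open>s\<close> lies below all the
    thresholds \<open>C / w k powr \<gamma>\<close>.\<close>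
  have "\<forall>\<^sub>F s in at_right (C / m powr \<gamma>). \<forall>k\<in>J. s < C / w k powr \<gamma>"
  proof (intro eventually_ball_finite J(1) ballI)
    fix k assume "k \<in> J"
    hence "C / m powr \<gamma> < C / w k powr \<gamma>"
      using par w[OF \<open>k \<in> J\<close>] \<open>m > 0\<close>
      by (intro divide_strict_left_mono powr_less_mono2 mult_pos_pos) auto
    thus "\<forall>\<^sub>F s in at_right (C / m powr \<gamma>). s < C / w k powr \<gamma>"
      by (auto simp: eventually_at_right_field)
  qed
  from eventually_conj[OF eventually_at_right_less this] obtain s
    where s: "C / m powr \<gamma> < s" "\<And>k. k \<in> J \<Longrightarrow> s < C / w k powr \<gamma>"
    using eventually_happens trivial_limit_at_right_real by blast
  define s' where "s' = (C / m powr \<gamma> + s) / 2"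
  have "0 < C / m powr \<gamma>" using par \<open>m > 0\<close> by simp
  have "s' - C / m powr \<gamma> = (s - C / m powr \<gamma>) / 2" "s - s' = (s - C / m powr \<gamma>) / 2"
    by (simp_all add: s'_def diff_divide_distrib add_divide_distrib)
  with s(1) \<open>0 < C / m powr \<gamma>\<close> have s': "C / m powr \<gamma> < s'" "s' < s" "0 < s'" by linarith+
  \<comment> \<open>The added 1 supplies the strict inequality that the tail bound for sums
    requires.\<close>
  define K where "K = (\<Sum>k\<in>J. 1 / w k) + 1"
  have "K > 0" unfolding K_def by (intro add_nonneg_pos sum_nonneg) (auto dest!: w(1))
  have upper: "\<forall>\<^sub>F x in at_top. prob {\<omega> \<in> space M. (\<Sum>k\<in>J. w k * \<epsilon> k \<omega>) > x} \<le> K * weibull_tail 0 s \<gamma> x"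
  proof (rule prob_sum_greaterThan_le)
    show "distributed M lborel (\<lambda>\<omega>. w k * \<epsilon> k \<omega>) (\<lambda>x. ennreal (f (x / w k) / w k))" if "k \<in> J" for k
      using distributed_scaled[OF dens w(1)[OF that], where b = 0] by simp
    show "asymp_dominated (weibull_weight 0 s \<gamma>) (1 / w k) (\<lambda>x. ennreal (f (x / w k) / w k))" if "k \<in> J" for k
      using h f par(2) w(1)[OF that] s(2)[OF that] by (rule stretched_exp_density_le)
  qed (use J par s' w indep_vars_scaled[OF indep] in \<open>auto simp: K_def intro: less_imp_le\<close>)
  obtain \<kappa> where \<kappa>: "\<kappa> > 0" "\<forall>\<^sub>F x in at_top. \<kappa> * weibull_tail 0 s' \<gamma> x \<le> v x"
    using v[OF s'(1)] by auto
  show ?thesis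
  proof (rule tendstoI)
    fix e :: real assume "e > 0"
    \<comment> \<open>This constant turns the bound on \<open>u x\<close> into
      \<open>e / 2 * v x\<close>.\<close>
    have "e * \<kappa> / (2 * K) > 0" using \<open>e > 0\<close> \<kappa> \<open>K > 0\<close> by simp
    from weibull_tail_dominated[OF s'(3,2) par(2) this, of 0] upper \<kappa>(2)
      eventually_weibull_tail_pos[OF s'(3) par(2), of 0]
    show "\<forall>\<^sub>F x in at_top. dist (u x / v x) 0 < e"
    proof eventually_elim
      case (elim x)
      have "u x \<le> K * weibull_tail 0 s \<gamma> x" using u(1)[of x] elim by linarith
      also have "\<dots> \<le> K * (e * \<kappa> / (2 * K) * weibull_tail 0 s' \<gamma> x)"
        using elim \<open>K > 0\<close> by (intro mult_left_mono) auto
      also have "\<dots> = e / 2 * (\<kappa> * weibull_tail 0 s' \<gamma> x)" using \<open>K > 0\<close> by simp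
      also have "\<dots> \<le> e / 2 * v x" using elim \<open>e > 0\<close> by (intro mult_left_mono) auto
      finally have "u x \<le> e / 2 * v x" .
      moreover have "0 < v x" using elim \<kappa>(1) by (auto intro: less_le_trans[OF mult_pos_pos])
      ultimately have "u x / v x \<le> e / 2" "0 \<le> u x / v x" using u(2)[of x] by (simp_all add: pos_divide_le_eq)
      thus ?case using \<open>e > 0\<close> unfolding dist_real_def by linarith
    qed
  qed
qed

text \<open>With the other noise variables bounded by \<open>A\<close>, it suffices that
  \<open>\<theta> k * \<epsilon> k\<close> exceeds \<open>x + B\<close>; this costs only a constant
  factor and a shift.\<close>

lemma prob_moving_average_ge:
  fixes \<epsilon> :: "int \<Rightarrow> 'a \<Rightarrow> real"
  assumes indep: "indep_vars (\<lambda>_. borel) \<epsilon> UNIV"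
    and dens: "\<And>i. distributed M lborel (\<epsilon> i) (\<lambda>x. ennreal (f x))"
    and h: "h \<in> o[at_top](\<lambda>x. x powr \<gamma>)"
    and f: "\<forall>\<^sub>F x in at_top. f x = exp (h x) * exp (- C * x powr \<gamma>)"
    and par: "C > 0" "0 < \<gamma>" "\<gamma> < 1"
    and \<theta>: "\<And>k. \<theta> k \<ge> 0" "finite {k. \<theta> k \<noteq> 0}" "\<theta> k > 0"
    and s: "s > C / \<theta> k powr \<gamma>"
  shows "\<exists>\<kappa>>0. \<forall>\<^sub>F x in at_top. \<kappa> * weibull_tail 0 s \<gamma> x \<le> prob {\<omega> \<in> space M. moving_average \<theta> \<epsilon> 0 \<omega> > x}"
proof -
  have [measurable]: "random_variable borel (\<epsilon> i)" for i
    using indep by (auto simp: indep_vars_def)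
  have [measurable]: "random_variable borel (moving_average \<theta> \<epsilon> i)" for i
    unfolding moving_average_def[abs_def] by measurable
  obtain A where A: "A \<ge> 0" "\<And>V. V \<in> sets borel \<Longrightarrow> 1 / 2 * prob {\<omega> \<in> space M. \<epsilon> k \<omega> \<in> V}
      \<le> prob {\<omega> \<in> space M. \<epsilon> k \<omega> \<in> V \<and> (\<forall>l\<in>{k. \<theta> k \<noteq> 0} - {k}. \<bar>\<epsilon> l \<omega>\<bar> \<le> A)}"
    using prob_one_free_others_bounded[OF indep \<theta>(2), of "1 / 2"] \<theta>(3) by auto
  define B where "B = A * (\<Sum>l | \<theta> l \<noteq> 0. \<theta> l)"
  have "0 < C / \<theta> k powr \<gamma>" using par \<theta> by simp
  with s have "0 < s" by linarith
  have "\<forall>\<^sub>F x in at_top. 1 / (2 * \<theta> k) * weibull_tail 0 s \<gamma> x \<le> prob {\<omega> \<in> space M. \<theta> k * \<epsilon> k \<omega> - B > x}"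
    using stretched_exp_density_ge[OF h f par(2,3) \<theta>(3) s] par \<theta> \<open>0 < s\<close>
    by (intro prob_greaterThan_ge[OF distributed_scaled[OF dens \<theta>(3)]]) auto
  hence "\<forall>\<^sub>F x in at_top. 1 / (4 * \<theta> k) * weibull_tail 0 s \<gamma> x \<le> prob {\<omega> \<in> space M. moving_average \<theta> \<epsilon> 0 \<omega> > x}"
  proof eventually_elim
    case (elim x)
    let ?V = "{y. \<theta> k * y - B > x}"
    \<comment> \<open>The 4 combines the 2 from the density bound with the 2 paid for bounding the
      other variables.\<close>
    have "1 / (4 * \<theta> k) * weibull_tail 0 s \<gamma> x \<le> 1 / 2 * prob {\<omega> \<in> space M. \<epsilon> k \<omega> \<in> ?V}"
      using elim by (simp add: field_simps)
    also have "\<dots> \<le> prob {\<omega> \<in> space M. \<epsilon> k \<omega> \<in> ?V \<and> (\<forall>l\<in>{k. \<theta> k \<noteq> 0} - {k}. \<bar>\<epsilon> l \<omega>\<bar> \<le> A)}"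
      by (intro A) measurable
    also have "\<dots> \<le> prob {\<omega> \<in> space M. moving_average \<theta> \<epsilon> 0 \<omega> > x}"
    proof (intro finite_measure_mono subsetI)
      fix \<omega> assume \<omega>: "\<omega> \<in> {\<omega> \<in> space M. \<epsilon> k \<omega> \<in> ?V \<and> (\<forall>l\<in>{k. \<theta> k \<noteq> 0} - {k}. \<bar>\<epsilon> l \<omega>\<bar> \<le> A)}"
      have "\<bar>moving_average \<theta> \<epsilon> 0 \<omega> - \<theta> (k - 0) * \<epsilon> k \<omega>\<bar> \<le> B"
        unfolding B_def using \<omega> \<theta> A by (intro moving_average_near_single_term) auto
      thus "\<omega> \<in> {\<omega> \<in> space M. moving_average \<theta> \<epsilon> 0 \<omega> > x}"
        using \<omega> by (auto simp: abs_le_iff)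
    qed measurable
    finally show ?case .
  qed
  thus ?thesis using \<theta>(3) by (intro exI[of _ "1 / (4 * \<theta> k)"]) auto
qed

text \<open>As \<open>i \<noteq> 0\<close>, the indices \<open>k\<close> and \<open>k - i\<close>
  are never both equal to \<open>k\<^sub>0\<close>, so the averaged weights \<open>w k\<close> stay
  strictly below the maximum.\<close>

lemma joint_exceedance_ratio_tendsto_0:
  fixes \<epsilon> :: "int \<Rightarrow> 'a \<Rightarrow> real"
  assumes indep: "indep_vars (\<lambda>_. borel) \<epsilon> UNIV"
    and dens: "\<And>i. distributed M lborel (\<epsilon> i) (\<lambda>x. ennreal (f x))"
    and h: "h \<in> o[at_top](\<lambda>x. x powr \<gamma>)"
    and f: "\<forall>\<^sub>F x in at_top. f x = exp (h x) * exp (- C * x powr \<gamma>)"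
    and par: "C > 0" "0 < \<gamma>" "\<gamma> < 1"
    and \<theta>: "\<And>k. \<theta> k \<ge> 0" "finite {k. \<theta> k \<noteq> 0}" "\<exists>k. \<theta> k \<noteq> 0"
    and max: "max_indices \<theta> = {k\<^sub>0}" and "i \<noteq> 0"
  shows "((\<lambda>x. prob {\<omega> \<in> space M. moving_average \<theta> \<epsilon> i \<omega> > x \<and> moving_average \<theta> \<epsilon> 0 \<omega> > x}
    / prob {\<omega> \<in> space M. moving_average \<theta> \<epsilon> 0 \<omega> > x}) \<longlongrightarrow> 0) at_top"
proof -
  have [measurable]: "random_variable borel (\<epsilon> i)" for i
    using indep by (auto simp: indep_vars_def)
  have [measurable]: "random_variable borel (moving_average \<theta> \<epsilon> i)" for i
    unfolding moving_average_def[abs_def] by measurable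
  have k\<^sub>0: "k\<^sub>0 \<in> max_indices \<theta>" using max by simp
  have "\<theta> k\<^sub>0 > 0" using max_indices_pos[OF k\<^sub>0 \<theta>(1,3)] .
  have less: "\<theta> k < \<theta> k\<^sub>0" if "k \<noteq> k\<^sub>0" for k
    using that mem_max_indices_iff[OF k\<^sub>0, of k] k\<^sub>0 max by (auto simp: max_indices_def less_le)
  have le: "\<theta> k \<le> \<theta> k\<^sub>0" for k using k\<^sub>0 by (simp add: max_indices_def)
  \<comment> \<open>On the union of the two supports each averaged weight is positive, so each
    summand has a density.\<close>
  define J where "J = {k. \<theta> k \<noteq> 0} \<union> (\<lambda>l. i + l) ` {k. \<theta> k \<noteq> 0}"
  define w where "w k = (\<theta> k + \<theta> (k - i)) / 2" for k
  have "finite J" "J \<noteq> {}" using \<theta> by (auto simp: J_def)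
  have avg: "moving_average \<theta> \<epsilon> 0 \<omega> = (\<Sum>k\<in>J. \<theta> k * \<epsilon> k \<omega>)"
      "moving_average \<theta> \<epsilon> i \<omega> = (\<Sum>k\<in>J. \<theta> (k - i) * \<epsilon> k \<omega>)" for \<omega>
    using \<open>finite J\<close> moving_average_eq_sum[of J 0 \<theta> \<epsilon> \<omega>] moving_average_eq_sum[of J i \<theta> \<epsilon> \<omega>]
    by (auto simp: J_def)
  have half_sum: "(\<Sum>k\<in>J. w k * \<epsilon> k \<omega>) = (moving_average \<theta> \<epsilon> 0 \<omega> + moving_average \<theta> \<epsilon> i \<omega>) / 2" for \<omega>
    by (simp add: avg w_def flip: sum.distrib sum_divide_distrib add: sum_divide_distrib algebra_simps add_divide_distrib)
  show ?thesis
  proof (rule prob_linear_combination_ratio_tendsto_0[OF indep dens h f par \<open>finite J\<close> \<open>J \<noteq> {}\<close>])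
    show "0 < w k" if "k \<in> J" for k
    proof -
      have "\<theta> k \<noteq> 0 \<or> \<theta> (k - i) \<noteq> 0" using that by (auto simp: J_def)
      with \<theta>(1)[of k] \<theta>(1)[of "k - i"] show ?thesis by (auto simp: w_def)
    qed
    show "w k < \<theta> k\<^sub>0" if "k \<in> J" for k
    proof (cases "k = k\<^sub>0")
      case True
      hence "\<theta> (k - i) < \<theta> k\<^sub>0" using \<open>i \<noteq> 0\<close> by (intro less) auto
      thus ?thesis using le[of k] by (simp add: w_def)
    next
      case False
      thus ?thesis using less[of k] le[of "k - i"] by (simp add: w_def)
    qed
    show "\<exists>\<kappa>>0. \<forall>\<^sub>F x in at_top. \<kappa> * weibull_tail 0 s \<gamma> x \<le> prob {\<omega> \<in> space M. moving_average \<theta> \<epsilon> 0 \<omega> > x}"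
      if "s > C / \<theta> k\<^sub>0 powr \<gamma>" for s
      by (rule prob_moving_average_ge[OF indep dens h f par \<theta>(1,2) \<open>\<theta> k\<^sub>0 > 0\<close> that])
    show "prob {\<omega> \<in> space M. moving_average \<theta> \<epsilon> i \<omega> > x \<and> moving_average \<theta> \<epsilon> 0 \<omega> > x}
      \<le> prob {\<omega> \<in> space M. (\<Sum>k\<in>J. w k * \<epsilon> k \<omega>) > x}" for x
      unfolding half_sum by (intro finite_measure_mono) (auto simp: field_simps, measurable)
  qed auto
qed

text \<open>A union bound over the finitely many nonzero \<open>i\<close> reduces this to
  pairs.\<close>

lemma unique_max_isolated_exceedance:
  fixes \<epsilon> :: "int \<Rightarrow> 'a \<Rightarrow> real"
  assumes indep: "indep_vars (\<lambda>_. borel) \<epsilon> UNIV"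
    and dens: "\<And>i. distributed M lborel (\<epsilon> i) (\<lambda>x. ennreal (f x))"
    and h: "h \<in> o[at_top](\<lambda>x. x powr \<gamma>)"
    and f: "\<forall>\<^sub>F x in at_top. f x = exp (h x) * exp (- C * x powr \<gamma>)"
    and par: "C > 0" "0 < \<gamma>" "\<gamma> < 1"
    and \<theta>: "\<And>k. \<theta> k \<ge> 0" "finite {k. \<theta> k \<noteq> 0}" "\<exists>k. \<theta> k \<noteq> 0"
    and max: "max_indices \<theta> = {k\<^sub>0}"
  shows "((\<lambda>x. \<P>(\<omega> in M. (\<exists>i. 1 \<le> \<bar>i\<bar> \<and> \<bar>i\<bar> \<le> i\<^sub>0 \<and> moving_average \<theta> \<epsilon> i \<omega> > x)
    \<bar> moving_average \<theta> \<epsilon> 0 \<omega> > x)) \<longlongrightarrow> 0) at_top"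
proof -
  let ?X = "moving_average \<theta> \<epsilon>"
  let ?I = "{- i\<^sub>0..i\<^sub>0} - {0}"
  have [measurable]: "random_variable borel (\<epsilon> i)" for i
    using indep by (auto simp: indep_vars_def)
  have [measurable]: "random_variable borel (?X i)" for i
    unfolding moving_average_def[abs_def] by measurable
  have "((\<lambda>x. \<Sum>i\<in>?I. prob {\<omega> \<in> space M. ?X i \<omega> > x \<and> ?X 0 \<omega> > x} / prob {\<omega> \<in> space M. ?X 0 \<omega> > x})
      \<longlongrightarrow> (\<Sum>i\<in>?I. 0)) at_top"
    by (intro tendsto_sum joint_exceedance_ratio_tendsto_0[OF indep dens h f par \<theta> max]) auto
  hence lim: "((\<lambda>x. \<Sum>i\<in>?I. prob {\<omega> \<in> space M. ?X i \<omega> > x \<and> ?X 0 \<omega> > x} / prob {\<omega> \<in> space M. ?X 0 \<omega> > x})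
      \<longlongrightarrow> 0) at_top" by simp
  show ?thesis
  proof (rule tendsto_sandwich[OF _ _ tendsto_const lim]; intro always_eventually allI)
    fix x :: real
    show "0 \<le> \<P>(\<omega> in M. (\<exists>i. 1 \<le> \<bar>i\<bar> \<and> \<bar>i\<bar> \<le> i\<^sub>0 \<and> ?X i \<omega> > x) \<bar> ?X 0 \<omega> > x)"
      by (simp add: cond_prob_def)
    have "{\<omega> \<in> space M. (\<exists>i. 1 \<le> \<bar>i\<bar> \<and> \<bar>i\<bar> \<le> i\<^sub>0 \<and> ?X i \<omega> > x) \<and> ?X 0 \<omega> > x}
        = (\<Union>i\<in>?I. {\<omega> \<in> space M. ?X i \<omega> > x \<and> ?X 0 \<omega> > x})"
    proof -
      have "1 \<le> \<bar>i\<bar> \<and> \<bar>i\<bar> \<le> i\<^sub>0 \<longleftrightarrow> i \<in> ?I" for i by auto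
      thus ?thesis by (auto simp del: Diff_iff)
    qed
    also have "prob \<dots> \<le> (\<Sum>i\<in>?I. prob {\<omega> \<in> space M. ?X i \<omega> > x \<and> ?X 0 \<omega> > x})"
      by (intro finite_measure_subadditive_finite) (simp, auto)
    finally show "\<P>(\<omega> in M. (\<exists>i. 1 \<le> \<bar>i\<bar> \<and> \<bar>i\<bar> \<le> i\<^sub>0 \<and> ?X i \<omega> > x) \<bar> ?X 0 \<omega> > x)
        \<le> (\<Sum>i\<in>?I. prob {\<omega> \<in> space M. ?X i \<omega> > x \<and> ?X 0 \<omega> > x} / prob {\<omega> \<in> space M. ?X 0 \<omega> > x})"
      unfolding cond_prob_def sum_divide_distrib[symmetric] by (intro divide_right_mono) auto
  qed
qed


section \<open>Part (ii): ties for the largest weight\<close>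

text \<open>Measured against the weight of the largest coefficient, each maximal term contributes
  the same constant and every other term contributes 0. The constants of the convolution bound
  therefore add up to the number of maximal indices times that constant.\<close>

lemma prob_moving_average_le:
  fixes \<epsilon> :: "int \<Rightarrow> 'a \<Rightarrow> real"
  assumes indep: "indep_vars (\<lambda>_. borel) \<epsilon> UNIV"
    and dens: "\<And>i. distributed M lborel (\<epsilon> i) (\<lambda>x. ennreal (f x))"
    and f: "f \<sim>[at_top] (\<lambda>x. C\<^sub>1 * x powr C\<^sub>2 * exp (- C * x powr \<gamma>))"
    and par: "C > 0" "C\<^sub>1 > 0" "C\<^sub>2 \<ge> 0" "0 < \<gamma>" "\<gamma> < 1"
    and \<theta>: "\<And>k. \<theta> k \<ge> 0" "finite {k. \<theta> k \<noteq> 0}"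
    and k\<^sub>0: "k\<^sub>0 \<in> max_indices \<theta>" "\<theta> k\<^sub>0 > 0"
    and \<kappa>: "\<kappa> > real (card (max_indices \<theta>)) * (C\<^sub>1 * \<theta> k\<^sub>0 powr (- 1 - C\<^sub>2))"
  shows "\<forall>\<^sub>F x in at_top. prob {\<omega> \<in> space M. moving_average \<theta> \<epsilon> 0 \<omega> > x}
    \<le> \<kappa> * weibull_tail C\<^sub>2 (C / \<theta> k\<^sub>0 powr \<gamma>) \<gamma> x"
proof -
  let ?S = "{k. \<theta> k \<noteq> 0}" and ?D = "C\<^sub>1 * \<theta> k\<^sub>0 powr (- 1 - C\<^sub>2)"
  define \<alpha> where "\<alpha> k = (if \<theta> k = \<theta> k\<^sub>0 then ?D else 0)" for k
  have pos: "0 < \<theta> k" if "k \<in> ?S" for k using that \<theta>(1)[of k] by simp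
  have "(\<Sum>k\<in>?S. \<alpha> k) = (\<Sum>k\<in>max_indices \<theta>. \<alpha> k)"
    using k\<^sub>0 \<theta>(2) by (intro sum.mono_neutral_right) (auto simp: mem_max_indices_iff[OF k\<^sub>0(1)] \<alpha>_def)
  also have "\<dots> = real (card (max_indices \<theta>)) * ?D"
    by (simp add: mem_max_indices_iff[OF k\<^sub>0(1)] \<alpha>_def)
  finally have sum_\<alpha>: "(\<Sum>k\<in>?S. \<alpha> k) < \<kappa>" using \<kappa> by simp
  have "\<forall>\<^sub>F x in at_top. prob {\<omega> \<in> space M. (\<Sum>k\<in>?S. \<theta> k * \<epsilon> k \<omega>) > x}
      \<le> \<kappa> * weibull_tail C\<^sub>2 (C / \<theta> k\<^sub>0 powr \<gamma>) \<gamma> x"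
  proof (rule prob_sum_greaterThan_le[OF _ _ _ _ _ _ _ _ _ _ sum_\<alpha>])
    show "distributed M lborel (\<lambda>\<omega>. \<theta> k * \<epsilon> k \<omega>) (\<lambda>x. ennreal (f (x / \<theta> k) / \<theta> k))" if "k \<in> ?S" for k
      using distributed_scaled[OF dens pos[OF that], where b = 0] by simp
    show "asymp_dominated (weibull_weight C\<^sub>2 (C / \<theta> k\<^sub>0 powr \<gamma>) \<gamma>) (\<alpha> k) (\<lambda>x. ennreal (f (x / \<theta> k) / \<theta> k))"
      if "k \<in> ?S" for k
    proof (rule asymp_dominated_of_tendsto)
      have "\<theta> k \<le> \<theta> k\<^sub>0" using k\<^sub>0 by (simp add: max_indices_def)
      from scaled_density_ratio[OF f par(1,2,4,5) pos[OF that] this, of 0]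
      show "((\<lambda>x. f (x / \<theta> k) / \<theta> k / weibull_weight C\<^sub>2 (C / \<theta> k\<^sub>0 powr \<gamma>) \<gamma> x) \<longlongrightarrow> \<alpha> k) at_top"
        by (cases "\<theta> k = \<theta> k\<^sub>0") (simp_all add: \<alpha>_def)
    qed
    show "?S \<noteq> {}" using k\<^sub>0(2) by (auto intro!: exI[of _ k\<^sub>0])
  qed (use par k\<^sub>0 \<theta> indep_vars_scaled[OF indep] in \<open>auto simp: \<alpha>_def\<close>)
  thus ?thesis by (simp add: moving_average_def)
qed

text \<open>Exceeding \<open>x + b\<close> has the full asymptotic constant, since the shift is
  invisible. Exceeding \<open>\<rho> * x\<close> is negligible, since it amounts to a variable with
  the smaller coefficient \<open>m / \<rho>\<close> exceeding \<open>x\<close>. Each of the two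
  estimates costs one \<open>\<eta>\<close>.\<close>

lemma prob_window_ge:
  fixes Y :: "'a \<Rightarrow> real"
  assumes dens: "distributed M lborel Y (\<lambda>x. ennreal (f x))"
    and f: "f \<sim>[at_top] (\<lambda>x. C\<^sub>1 * x powr C\<^sub>2 * exp (- C * x powr \<gamma>))"
    and par: "C > 0" "C\<^sub>1 > 0" "C\<^sub>2 \<ge> 0" "0 < \<gamma>" "\<gamma> < 1" "0 < m" "1 < \<rho>" "0 \<le> b"
    and \<eta>: "0 < \<eta>" "\<eta> < 1"
  shows "\<forall>\<^sub>F x in at_top. (1 - 2 * \<eta>) * (C\<^sub>1 * m powr (- 1 - C\<^sub>2)) * weibull_tail C\<^sub>2 (C / m powr \<gamma>) \<gamma> x
    \<le> prob {\<omega> \<in> space M. x + b < m * Y \<omega> \<and> m * Y \<omega> \<le> \<rho> * x}"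
proof -
  let ?D = "C\<^sub>1 * m powr (- 1 - C\<^sub>2)" and ?T = "weibull_tail C\<^sub>2 (C / m powr \<gamma>) \<gamma>"
  have [measurable]: "random_variable borel Y" using distributed_measurable[OF dens] by simp
  have "?D > 0" using par by simp
  have "m / \<rho> > 0" "m / \<rho> \<noteq> m" "m / \<rho> \<le> m" using par by (auto simp: field_simps)
  have c: "C / m powr \<gamma> > 0" using par by simp
  have "\<forall>\<^sub>F x in at_top. (1 - \<eta>) * ?D * ?T x \<le> prob {\<omega> \<in> space M. m * Y \<omega> - b > x}"
  proof (rule prob_greaterThan_ge[OF distributed_scaled[OF dens \<open>0 < m\<close>] c par(4)])
    show "\<forall>\<^sub>F x in at_top. ennreal ((1 - \<eta>) * ?D * weibull_weight C\<^sub>2 (C / m powr \<gamma>) \<gamma> x) \<le> ennreal (f ((x + b) / m) / m)"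
    proof (rule eventually_ge_of_tendsto)
      show "((\<lambda>x. f ((x + b) / m) / m / weibull_weight C\<^sub>2 (C / m powr \<gamma>) \<gamma> x) \<longlongrightarrow> ?D) at_top"
        using scaled_density_ratio[OF f par(1,2,4,5,6) order_refl, of b] by simp
      show "(1 - \<eta>) * ?D < ?D" using \<eta> mult_strict_right_mono[OF _ \<open>?D > 0\<close>, of "1 - \<eta>" 1] by simp
    qed
  qed (use \<eta> \<open>?D > 0\<close> in auto)
  moreover have "\<forall>\<^sub>F x in at_top. prob {\<omega> \<in> space M. m / \<rho> * Y \<omega> - 0 > x} \<le> \<eta> * ?D * ?T x"
  proof (rule prob_greaterThan_le[OF distributed_scaled[OF dens \<open>m / \<rho> > 0\<close>] c par(4)])
    have "asymp_dominated (weibull_weight C\<^sub>2 (C / m powr \<gamma>) \<gamma>) 0 (\<lambda>x. ennreal (f ((x + 0) / (m / \<rho>)) / (m / \<rho>)))"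
      using scaled_density_ratio[OF f par(1,2,4,5) \<open>m / \<rho> > 0\<close> \<open>m / \<rho> \<le> m\<close>, of 0] \<open>m / \<rho> \<noteq> m\<close>
      by (intro asymp_dominated_of_tendsto) simp
    thus "\<forall>\<^sub>F x in at_top. ennreal (f ((x + 0) / (m / \<rho>)) / (m / \<rho>)) \<le> ennreal (\<eta> * ?D * weibull_weight C\<^sub>2 (C / m powr \<gamma>) \<gamma> x)"
      unfolding asymp_dominated_def using \<eta> \<open>?D > 0\<close> by (metis mult_pos_pos)
  qed (use \<eta> \<open>?D > 0\<close> in auto)
  ultimately show ?thesis
  proof eventually_elim
    case (elim x)
    have "(1 - 2 * \<eta>) * ?D * ?T x = (1 - \<eta>) * ?D * ?T x - \<eta> * ?D * ?T x"
      by (simp add: algebra_simps)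
    also have "\<dots> \<le> prob {\<omega> \<in> space M. m * Y \<omega> - b > x} - prob {\<omega> \<in> space M. m / \<rho> * Y \<omega> - 0 > x}"
      using elim by (intro diff_mono)
    also have "\<dots> \<le> prob {\<omega> \<in> space M. x + b < m * Y \<omega> \<and> m * Y \<omega> \<le> \<rho> * x}"
    proof -
      have "prob {\<omega> \<in> space M. m * Y \<omega> - b > x}
          \<le> prob ({\<omega> \<in> space M. m / \<rho> * Y \<omega> - 0 > x} \<union> {\<omega> \<in> space M. x + b < m * Y \<omega> \<and> m * Y \<omega> \<le> \<rho> * x})"
        using par by (intro finite_measure_mono) (auto simp: field_simps)
      also have "\<dots> \<le> prob {\<omega> \<in> space M. m / \<rho> * Y \<omega> - 0 > x}
          + prob {\<omega> \<in> space M. x + b < m * Y \<omega> \<and> m * Y \<omega> \<le> \<rho> * x}"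
        by (intro measure_Un_le) measurable
      finally show ?thesis by simp
    qed
    finally show ?case .
  qed
qed

lemma measurable_exceedance_count:
  fixes X :: "int \<Rightarrow> 'a \<Rightarrow> real"
  assumes [measurable]: "\<And>j. random_variable borel (X j)"
  shows "exceedance_count X r x \<in> measurable M (count_space UNIV)"
proof -
  have "exceedance_count X r x = (\<lambda>\<omega>. \<Sum>j\<in>{- r..r}. if X j \<omega> > x then 1 else 0)"
  proof
    fix \<omega>
    have "{j. \<bar>j\<bar> \<le> r \<and> X j \<omega> > x} = {- r..r} \<inter> {j. X j \<omega> > x}" by auto
    thus "exceedance_count X r x \<omega> = (\<Sum>j\<in>{- r..r}. if X j \<omega> > x then 1 else 0)"
      by (simp add: exceedance_count_def sum.If_cases)
  qed
  also have "\<dots> \<in> measurable M (count_space UNIV)" by measurable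
  finally show ?thesis .
qed

text \<open>The events \<open>E x k\<close> for maximal \<open>k\<close> are disjoint and each
  forces the desired count. The factor \<open>1 - \<eta>\<close> pays for bounding the other
  variables, \<open>1 - 2 * \<eta>\<close> for the window. The lower end of the window makes the
  maximal weights exceed \<open>x\<close>; the upper end keeps all other weights from doing
  so.\<close>

lemma prob_exceedance_count_ge:
  fixes \<epsilon> :: "int \<Rightarrow> 'a \<Rightarrow> real"
  assumes indep: "indep_vars (\<lambda>_. borel) \<epsilon> UNIV"
    and dens: "\<And>i. distributed M lborel (\<epsilon> i) (\<lambda>x. ennreal (f x))"
    and f: "f \<sim>[at_top] (\<lambda>x. C\<^sub>1 * x powr C\<^sub>2 * exp (- C * x powr \<gamma>))"
    and par: "C > 0" "C\<^sub>1 > 0" "C\<^sub>2 \<ge> 0" "0 < \<gamma>" "\<gamma> < 1"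
    and \<theta>: "\<And>k. \<theta> k \<ge> 0" "finite {k. \<theta> k \<noteq> 0}"
    and r: "Max {k. \<theta> k \<noteq> 0} - Min {k. \<theta> k \<noteq> 0} \<le> r"
    and k\<^sub>0: "k\<^sub>0 \<in> max_indices \<theta>" "\<theta> k\<^sub>0 > 0"
    and \<eta>: "0 < \<eta>" "\<eta> < 1"
  shows "\<forall>\<^sub>F x in at_top. (1 - \<eta>) * (1 - 2 * \<eta>) * (real (card (max_indices \<theta>)) * (C\<^sub>1 * \<theta> k\<^sub>0 powr (- 1 - C\<^sub>2)))
      * weibull_tail C\<^sub>2 (C / \<theta> k\<^sub>0 powr \<gamma>) \<gamma> x
    \<le> prob {\<omega> \<in> space M. exceedance_count (moving_average \<theta> \<epsilon>) r x \<omega> = card (max_indices \<theta>)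
        \<and> moving_average \<theta> \<epsilon> 0 \<omega> > x}"
proof -
  let ?S = "{k. \<theta> k \<noteq> 0}" and ?K = "max_indices \<theta>" and ?X = "moving_average \<theta> \<epsilon>"
  let ?m = "\<theta> k\<^sub>0" and ?D = "C\<^sub>1 * \<theta> k\<^sub>0 powr (- 1 - C\<^sub>2)" and ?T = "weibull_tail C\<^sub>2 (C / \<theta> k\<^sub>0 powr \<gamma>) \<gamma>"
  have [measurable]: "random_variable borel (\<epsilon> i)" for i
    using indep by (auto simp: indep_vars_def)
  have [measurable]: "random_variable borel (?X i)" for i
    unfolding moving_average_def[abs_def] by measurable
  note measurable_exceedance_count[of ?X, measurable]
  have K: "k \<in> ?K \<longleftrightarrow> \<theta> k = ?m" for k by (rule mem_max_indices_iff[OF k\<^sub>0(1)])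
  have "?K \<subseteq> ?S" using k\<^sub>0 by (auto simp: K)
  hence "finite ?K" using \<theta>(2) by (rule finite_subset)
  have "0 \<le> r"
  proof -
    have "?S \<noteq> {}" using k\<^sub>0(2) by (auto intro!: exI[of _ k\<^sub>0])
    hence "Min ?S \<le> Max ?S" using \<theta>(2) by (intro Min_le Max_in)
    thus ?thesis using r by linarith
  qed
  \<comment> \<open>These are the indices of all noise variables that enter an average inside the
    counting window.\<close>
  define J where "J = (\<lambda>(j, l). j + l) ` ({- r..r} \<times> ?S)"
  have "finite J" using \<theta> by (simp add: J_def)
  have J: "j + l \<in> J" if "\<bar>j\<bar> \<le> r" "\<theta> l \<noteq> 0" for j l
    using that by (auto simp: J_def image_iff intro!: bexI[of _ j])
  have "?K \<subseteq> J" using \<open>?K \<subseteq> ?S\<close> J[of 0] \<open>0 \<le> r\<close> by auto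
  obtain A where A: "A \<ge> 0" "\<And>k V. k \<in> J \<Longrightarrow> V \<in> sets borel \<Longrightarrow> (1 - \<eta>) * prob {\<omega> \<in> space M. \<epsilon> k \<omega> \<in> V}
      \<le> prob {\<omega> \<in> space M. \<epsilon> k \<omega> \<in> V \<and> (\<forall>l\<in>J - {k}. \<bar>\<epsilon> l \<omega>\<bar> \<le> A)}"
    using prob_one_free_others_bounded[OF indep \<open>finite J\<close>, of "1 - \<eta>"] \<eta>(1) by auto
  define B where "B = A * (\<Sum>l\<in>?S. \<theta> l)"
  have "B \<ge> 0" using A \<theta> by (auto simp: B_def intro!: mult_nonneg_nonneg sum_nonneg)
  \<comment> \<open>Only finitely many weights are nonzero, so some \<open>\<rho> > 1\<close> keeps
    all the smaller ones below the maximum after multiplication.\<close>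
  have "\<forall>\<^sub>F \<rho> in at_right 1. \<forall>l\<in>?S. \<theta> l < ?m \<longrightarrow> \<theta> l * \<rho> < ?m"
  proof (intro eventually_ball_finite \<theta>(2) ballI)
    fix l
    have "((\<lambda>\<rho>. \<theta> l * \<rho>) \<longlongrightarrow> \<theta> l * 1) (at_right 1)" by (intro tendsto_intros)
    thus "\<forall>\<^sub>F \<rho> in at_right 1. \<theta> l < ?m \<longrightarrow> \<theta> l * \<rho> < ?m"
      by (cases "\<theta> l < ?m") (auto dest: order_tendstoD)
  qed
  from eventually_conj[OF eventually_at_right_less this] obtain \<rho>
    where \<rho>: "1 < \<rho>" "\<And>l. \<theta> l \<noteq> 0 \<Longrightarrow> \<theta> l < ?m \<Longrightarrow> \<theta> l * \<rho> < ?m"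
    using eventually_happens trivial_limit_at_right_real by blast
  \<comment> \<open>Here \<open>l\<close> ranges over values of the weights, not indices, which
    leaves finitely many conditions; the value 0, inserted explicitly, covers all indices outside
    the support.\<close>
  have low: "\<forall>\<^sub>F x in at_top. \<forall>l\<in>insert 0 (\<theta> ` ?S). l < ?m \<longrightarrow> l / ?m * (\<rho> * x) \<le> x - B"
  proof (intro eventually_ball_finite ballI)
    fix l assume l: "l \<in> insert 0 (\<theta> ` ?S)"
    show "\<forall>\<^sub>F x in at_top. l < ?m \<longrightarrow> l / ?m * (\<rho> * x) \<le> x - B"
    proof (cases "l < ?m")
      case True
      hence "l * \<rho> < ?m" using l \<rho> k\<^sub>0 by auto
      hence pos: "1 - l * \<rho> / ?m > 0" using k\<^sub>0 by simp
      have "\<forall>\<^sub>F x in at_top. x \<ge> B / (1 - l * \<rho> / ?m)" by (rule eventually_ge_at_top)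
      thus ?thesis
      proof eventually_elim
        case (elim x)
        hence "B \<le> x * (1 - l * \<rho> / ?m)" using pos by (simp only: pos_divide_le_eq)
        thus ?case by (simp add: algebra_simps)
      qed
    qed simp
  qed (use \<theta> in auto)
  define V where "V x = {y. x + B < ?m * y \<and> ?m * y \<le> \<rho> * x}" for x
  have [measurable]: "V x \<in> sets borel" for x unfolding V_def by measurable
  define E where "E x k = {\<omega> \<in> space M. \<epsilon> k \<omega> \<in> V x \<and> (\<forall>l\<in>J - {k}. \<bar>\<epsilon> l \<omega>\<bar> \<le> A)}" for x k
  have [measurable]: "E x k \<in> sets M" for x k
    unfolding E_def using \<open>finite J\<close> by measurable
  have "\<forall>\<^sub>F x in at_top. \<forall>k\<in>?K. (1 - 2 * \<eta>) * ?D * ?T x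
      \<le> prob {\<omega> \<in> space M. x + B < ?m * \<epsilon> k \<omega> \<and> ?m * \<epsilon> k \<omega> \<le> \<rho> * x}"
    by (intro eventually_ball_finite ballI \<open>finite ?K\<close> prob_window_ge[OF dens f]
        par k\<^sub>0 \<rho>(1) \<open>B \<ge> 0\<close> \<eta>)
  thus ?thesis using low eventually_gt_at_top[of "?m * A"]
  proof eventually_elim
    case (elim x)
    have "0 \<le> ?m * A" using k\<^sub>0 A by simp
    hence "x > 0" using elim by linarith
    have "(1 - \<eta>) * (1 - 2 * \<eta>) * (real (card ?K) * ?D) * ?T x = (\<Sum>k\<in>?K. (1 - \<eta>) * ((1 - 2 * \<eta>) * ?D * ?T x))"
      by simp
    also have "\<dots> \<le> (\<Sum>k\<in>?K. prob (E x k))"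
    proof (rule sum_mono)
      fix k assume k: "k \<in> ?K"
      have "(1 - \<eta>) * ((1 - 2 * \<eta>) * ?D * ?T x) \<le> (1 - \<eta>) * prob {\<omega> \<in> space M. \<epsilon> k \<omega> \<in> V x}"
        using elim k \<eta> unfolding V_def by (intro mult_left_mono) auto
      also have "\<dots> \<le> prob (E x k)"
        unfolding E_def using k \<open>?K \<subseteq> J\<close> by (intro A) auto
      finally show "(1 - \<eta>) * ((1 - 2 * \<eta>) * ?D * ?T x) \<le> prob (E x k)" .
    qed
    also have "\<dots> = prob (\<Union>k\<in>?K. E x k)"
    proof (rule finite_measure_finite_Union[symmetric])
      \<comment> \<open>On \<open>E x l\<close> with \<open>l \<noteq> k\<close> the variable
        \<open>\<epsilon> k\<close> is at most \<open>A\<close>, whereas \<open>E x k\<close> asks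
        for \<open>?m * \<epsilon> k \<omega> > x + B\<close>; this is impossible once
        \<open>x > ?m * A\<close>.\<close>
      show "disjoint_family_on (E x) ?K"
      proof (unfold disjoint_family_on_def, intro ballI impI equals0I)
        fix k l \<omega> assume kl: "k \<in> ?K" "l \<in> ?K" "k \<noteq> l" "\<omega> \<in> E x k \<inter> E x l"
        hence "x + B < ?m * \<epsilon> k \<omega>" "\<bar>\<epsilon> k \<omega>\<bar> \<le> A"
          using \<open>?K \<subseteq> J\<close> by (auto simp: E_def V_def)
        moreover from this(2) have "?m * \<epsilon> k \<omega> \<le> ?m * A"
          using k\<^sub>0 by (intro mult_left_mono) auto
        ultimately show False using elim \<open>B \<ge> 0\<close> by linarith
      qed
    qed (use \<open>finite ?K\<close> in auto)
    also have "\<dots> \<le> prob {\<omega> \<in> space M. exceedance_count ?X r x \<omega> = card ?K \<and> ?X 0 \<omega> > x}"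
    proof (intro finite_measure_mono subsetI)
      fix \<omega> assume "\<omega> \<in> (\<Union>k\<in>?K. E x k)"
      then obtain k where k: "k \<in> ?K" and \<omega>: "\<omega> \<in> E x k" by auto
      have \<theta>k: "\<theta> k = ?m" using k by (simp add: K)
      have small: "\<bar>\<epsilon> (j + l) \<omega>\<bar> \<le> A" if "\<bar>j\<bar> \<le> r" "\<theta> l \<noteq> 0" "j + l \<noteq> k" for j l
        using \<omega> J[OF that(1,2)] that(3) by (auto simp: E_def)
      have big: "\<theta> k * \<epsilon> k \<omega> > x + A * (\<Sum>l\<in>?S. \<theta> l)"
        using \<omega> by (auto simp: E_def V_def B_def \<theta>k)
      have low': "\<theta> l * \<epsilon> k \<omega> \<le> x - A * (\<Sum>l\<in>?S. \<theta> l)" if "\<theta> l < \<theta> k" for l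
      proof -
        have "\<theta> l * \<epsilon> k \<omega> = \<theta> l / ?m * (?m * \<epsilon> k \<omega>)" using k\<^sub>0 by simp
        also have "\<dots> \<le> \<theta> l / ?m * (\<rho> * x)"
          using \<omega> \<theta>(1)[of l] k\<^sub>0 by (intro mult_left_mono) (auto simp: E_def V_def)
        also have "\<dots> \<le> x - B" using elim that \<theta>k by (cases "\<theta> l = 0") auto
        finally show ?thesis by (simp add: B_def)
      qed
      have "\<theta> k > 0" using k\<^sub>0 \<theta>k by simp
      show "\<omega> \<in> {\<omega> \<in> space M. exceedance_count ?X r x \<omega> = card ?K \<and> ?X 0 \<omega> > x}"
        using exceedance_count_single_big_term[where \<epsilon> = \<epsilon> and \<omega> = \<omega> and x = x, OF \<theta>(2,1) r k \<open>\<theta> k > 0\<close> A(1) small big low'] \<omega>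
        by (simp add: E_def)
    qed measurable
    finally show ?case .
  qed
qed

text \<open>The joint probability and that of the conditioning event are both squeezed against the
  scale \<open>?qD * ?T x\<close>, with constants arbitrarily close to 1.\<close>

lemma tied_max_exceedance_count:
  fixes \<epsilon> :: "int \<Rightarrow> 'a \<Rightarrow> real"
  assumes indep: "indep_vars (\<lambda>_. borel) \<epsilon> UNIV"
    and dens: "\<And>i. distributed M lborel (\<epsilon> i) (\<lambda>x. ennreal (f x))"
    and f: "f \<sim>[at_top] (\<lambda>x. C\<^sub>1 * x powr C\<^sub>2 * exp (- C * x powr \<gamma>))"
    and par: "C > 0" "C\<^sub>1 > 0" "C\<^sub>2 \<ge> 0" "0 < \<gamma>" "\<gamma> < 1"
    and \<theta>: "\<And>k. \<theta> k \<ge> 0" "finite {k. \<theta> k \<noteq> 0}"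
    and r: "Max {k. \<theta> k \<noteq> 0} - Min {k. \<theta> k \<noteq> 0} \<le> r"
    and k\<^sub>0: "k\<^sub>0 \<in> max_indices \<theta>" "\<theta> k\<^sub>0 > 0"
  shows "((\<lambda>x. \<P>(\<omega> in M. exceedance_count (moving_average \<theta> \<epsilon>) r x \<omega> = card (max_indices \<theta>)
    \<bar> moving_average \<theta> \<epsilon> 0 \<omega> > x)) \<longlongrightarrow> 1) at_top"
proof -
  let ?X = "moving_average \<theta> \<epsilon>"
  let ?qD = "real (card (max_indices \<theta>)) * (C\<^sub>1 * \<theta> k\<^sub>0 powr (- 1 - C\<^sub>2))" and ?T = "weibull_tail C\<^sub>2 (C / \<theta> k\<^sub>0 powr \<gamma>) \<gamma>"
  have [measurable]: "random_variable borel (\<epsilon> i)" for i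
    using indep by (auto simp: indep_vars_def)
  have [measurable]: "random_variable borel (?X i)" for i
    unfolding moving_average_def[abs_def] by measurable
  have "max_indices \<theta> \<subseteq> {k. \<theta> k \<noteq> 0}" using k\<^sub>0 by (auto simp: mem_max_indices_iff[OF k\<^sub>0(1)])
  hence "finite (max_indices \<theta>)" using \<theta>(2) by (rule finite_subset)
  with k\<^sub>0(1) have "card (max_indices \<theta>) > 0" by (auto simp: card_gt_0_iff)
  hence "?qD > 0" using k\<^sub>0(2) par(2) by simp
  show ?thesis unfolding cond_prob_def
  proof (rule tendsto_divide_1_of_bounds[where t = "\<lambda>x. ?qD * ?T x"])
    have "C / \<theta> k\<^sub>0 powr \<gamma> > 0" using par k\<^sub>0 by simp
    from eventually_weibull_tail_pos[OF this par(4), of C\<^sub>2] show "\<forall>\<^sub>F x in at_top. ?qD * ?T x > 0"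
      by eventually_elim (use \<open>?qD > 0\<close> in simp)
  next
    fix x show "prob {\<omega> \<in> space M. exceedance_count ?X r x \<omega> = card (max_indices \<theta>) \<and> ?X 0 \<omega> > x}
        \<le> prob {\<omega> \<in> space M. ?X 0 \<omega> > x}"
      by (intro finite_measure_mono) auto
  next
    fix \<kappa> :: real assume "0 < \<kappa>" "\<kappa> < 1"
    \<comment> \<open>Chosen so that (1 - \<eta>)(1 - 2\<eta>) \<ge> 1 - 3\<eta> = \<kappa>.\<close>
    define \<eta> where "\<eta> = (1 - \<kappa>) / 3"
    have \<eta>: "0 < \<eta>" "\<eta> < 1" using \<open>0 < \<kappa>\<close> \<open>\<kappa> < 1\<close> by (auto simp: \<eta>_def)
    have "\<kappa> = 1 - 3 * \<eta>" by (simp add: \<eta>_def diff_divide_distrib)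
    also have "\<dots> \<le> (1 - \<eta>) * (1 - 2 * \<eta>)" by (simp add: algebra_simps)
    finally have \<kappa>: "\<kappa> \<le> (1 - \<eta>) * (1 - 2 * \<eta>)" .
    show "\<forall>\<^sub>F x in at_top. \<kappa> * (?qD * ?T x)
        \<le> prob {\<omega> \<in> space M. exceedance_count ?X r x \<omega> = card (max_indices \<theta>) \<and> ?X 0 \<omega> > x}"
      using prob_exceedance_count_ge[OF indep dens f par \<theta> r k\<^sub>0 \<eta>]
    proof eventually_elim
      case (elim x)
      have "\<kappa> * (?qD * ?T x) \<le> (1 - \<eta>) * (1 - 2 * \<eta>) * (?qD * ?T x)"
        by (rule mult_right_mono[OF \<kappa> mult_nonneg_nonneg[OF less_imp_le[OF \<open>?qD > 0\<close>]]]) simp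
      also have "\<dots> = (1 - \<eta>) * (1 - 2 * \<eta>) * ?qD * ?T x" by (simp only: mult.assoc)
      finally show ?case using elim by linarith
    qed
  next
    fix \<kappa> :: real assume "1 < \<kappa>"
    hence "?qD < \<kappa> * ?qD" using mult_strict_right_mono[OF _ \<open>?qD > 0\<close>, of 1 \<kappa>] by (simp only: mult_1_left)
    from prob_moving_average_le[OF indep dens f par \<theta> k\<^sub>0 this]
    show "\<forall>\<^sub>F x in at_top. prob {\<omega> \<in> space M. ?X 0 \<omega> > x} \<le> \<kappa> * (?qD * ?T x)"
      by (simp only: mult.assoc)
  qed
qed

end

theorem theorem3p4:
  fixes S :: "'a measure"
    and \<epsilon> :: "int \<Rightarrow> 'a \<Rightarrow> real"
    and f :: "real \<Rightarrow> real"
    and \<theta> :: "int \<Rightarrow> real"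
    and X :: "int \<Rightarrow> 'a \<Rightarrow> real"
    and r :: int
  assumes "prob_space S"
    and "prob_space.indep_vars S (\<lambda>_. borel) \<epsilon> UNIV"
    and "\<And>x. f x \<ge> 0"
    and "\<And>i. distributed S lborel (\<epsilon> i) (\<lambda>x. ennreal (f x))"
    and "\<And>k. \<theta> k \<ge> 0"
    and "finite {k. \<theta> k \<noteq> 0}"
    and "\<exists>k. \<theta> k \<noteq> 0"
    and X: "X = moving_average \<theta> \<epsilon>"
    and "Max {k. \<theta> k \<noteq> 0} - Min {k. \<theta> k \<noteq> 0} \<le> r"
  shows
    "(\<forall>C \<gamma> :: real.
        C > 0 \<and> 0 < \<gamma> \<and> \<gamma> < 1 \<and>
        (\<exists>h. h \<in> o[at_top](\<lambda>x. x powr \<gamma>) \<and>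
             (\<forall>\<^sub>F x in at_top. f x = exp (h x) * exp (- C * x powr \<gamma>))) \<and>
        (\<exists>!k. k \<in> max_indices \<theta>) \<longrightarrow>
        (\<forall>i\<^sub>0 :: int. i\<^sub>0 \<ge> 1 \<longrightarrow>
          ((\<lambda>x. \<P>(\<omega> in S. (\<exists>i. 1 \<le> \<bar>i\<bar> \<and> \<bar>i\<bar> \<le> i\<^sub>0 \<and> X i \<omega> > x) \<bar> X 0 \<omega> > x)) \<longlongrightarrow> 0) at_top))
     \<and>
     (\<forall>(C :: real) (C\<^sub>1 :: real) (C\<^sub>2 :: real) (\<gamma> :: real) (q :: nat).
        C > 0 \<and> C\<^sub>1 > 0 \<and> C\<^sub>2 \<ge> 0 \<and> 0 < \<gamma> \<and> \<gamma> < 1 \<and>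
        f \<sim>[at_top] (\<lambda>x. C\<^sub>1 * x powr C\<^sub>2 * exp (- C * x powr \<gamma>)) \<and>
        q \<ge> 2 \<and> card (max_indices \<theta>) = q \<longrightarrow>
        ((\<lambda>x. \<P>(\<omega> in S. exceedance_count X r x \<omega> = q \<bar> X 0 \<omega> > x)) \<longlongrightarrow> 1) at_top)"
proof (intro conjI allI impI)
  interpret prob_space S by fact
  note basic = assms(2) assms(4)
  fix C \<gamma> :: real and i\<^sub>0 :: int
  assume *: "C > 0 \<and> 0 < \<gamma> \<and> \<gamma> < 1 \<and>
      (\<exists>h. h \<in> o[at_top](\<lambda>x. x powr \<gamma>) \<and>
        (\<forall>\<^sub>F x in at_top. f x = exp (h x) * exp (- C * x powr \<gamma>))) \<and>
      (\<exists>!k. k \<in> max_indices \<theta>)"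
  then obtain h k\<^sub>0 where h: "h \<in> o[at_top](\<lambda>x. x powr \<gamma>)"
      "\<forall>\<^sub>F x in at_top. f x = exp (h x) * exp (- C * x powr \<gamma>)"
    and k\<^sub>0: "max_indices \<theta> = {k\<^sub>0}" by blast
  show "((\<lambda>x. \<P>(\<omega> in S. (\<exists>i. 1 \<le> \<bar>i\<bar> \<and> \<bar>i\<bar> \<le> i\<^sub>0 \<and> X i \<omega> > x) \<bar> X 0 \<omega> > x)) \<longlongrightarrow> 0) at_top"
    unfolding X using * by (intro unique_max_isolated_exceedance[OF basic h _ _ _ assms(5-7) k\<^sub>0]) auto
next
  interpret prob_space S by fact
  fix C C\<^sub>1 C\<^sub>2 \<gamma> :: real and q :: nat
  assume *: "C > 0 \<and> C\<^sub>1 > 0 \<and> C\<^sub>2 \<ge> 0 \<and> 0 < \<gamma> \<and> \<gamma> < 1 \<and>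
      f \<sim>[at_top] (\<lambda>x. C\<^sub>1 * x powr C\<^sub>2 * exp (- C * x powr \<gamma>)) \<and>
      q \<ge> 2 \<and> card (max_indices \<theta>) = q"
  \<comment> \<open>An empty set has cardinality 0, so \<open>q \<ge> 2\<close> guarantees a maximal
    index.\<close>
  then obtain k\<^sub>0 where k\<^sub>0: "k\<^sub>0 \<in> max_indices \<theta>" by fastforce
  have "card (max_indices \<theta>) = q" using * by simp
  thus "((\<lambda>x. \<P>(\<omega> in S. exceedance_count X r x \<omega> = q \<bar> X 0 \<omega> > x)) \<longlongrightarrow> 1) at_top"
    unfolding X using * max_indices_pos[OF k\<^sub>0 assms(5,7)] assms(9)
    by (auto intro!: tied_max_exceedance_count[OF assms(2,4) _ _ _ _ _ _ assms(5,6) _ k\<^sub>0])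
qed

end
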